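(* Suppose that $X$ is a non-compact proper metric space which is coarsely geodesic and has coarse bounded geometry. Then the Higson corona $\nu X$ of $X$ is an indecomposable continuum if and only if $X$ is coarsely equivalent to $\mathbb{N}$.
   Context: $\mathbb{R}_+=[0,\infty)$ carries the metric $d(x,y)=|x-y|$, and $\mathbb{N}\subset\mathbb{R}_+$ is the space of natural numbers with the induced metric. A metric space $(X,d_X)$ is proper if every closed ball $B(x,r)=\{y\in X : d_X(x,y)\le r\}$ is compact. Coarse equivalence: A (not necessarily continuous) function $f:X\to Y$ between metric spaces is a coarse map if (a) there is a non-decreasing function $\sigma:\mathbb{R}_+\to\mathbb{R}_+$ with $d_Y(f(x),f(x'))\le\sigma(d_X(x,x'))$ for all $x,x'\in X$, and (b) $f^{-1}(B)$ is bounded for every bounded $B\subset Y$. Two maps $f,g:X\to Y$ are close if there is $r>0$ with $d_Y(f(x),g(x))<r$ for all $x\in X$. A coarse map $f:X\to Y$ is a coarse equivalence if there is a coarse map $g:Y\to X$ such that $g\circ f$ is close to $\mathrm{id}_X$ and $f\circ g$ is close to $\mathrm{id}_Y$; then $X$ and $Y$ are called coarsely equivalent. A metric space is coarsely geodesic if it is coarsely equivalent to a geodesic metric space. A subset $A\subset X$ is a net if there is $r>0$ such that for every $x\in X$ there is $a\in A$ with $d_X(x,a)<r$. A metric space $X$ has coarse bounded geometry if there exist a net $A$ of $X$ and a function $\lambda:\mathbb{R}_+\to\mathbb{R}_+$ such that $\#(A\cap B(x,t))\le\lambda(t)$ for every $x\in X$ and $t>0$. Higson corona: for a proper metric space $X$,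 let $C_H(X)$ be the set of bounded continuous functions $f:X\to\mathbb{R}$ such that for all $r>0$ and $\varepsilon>0$ there is a compact $K\subset X$ with $\operatorname{diam} f(B(x,r))<\varepsilon$ for all $x\in X\setminus K$. The evaluation map $e:X\to\prod_{f\in C_H(X)}[\inf f,\sup f]$, $(e(x))_f=f(x)$, is a topological embedding; the Higson compactification $X^\nu$ is the closure of $e(X)$ (with $X$ identified with $e(X)$), and the Higson corona is $\nu X=X^\nu\setminus X$. A continuum is a non-empty compact connected Hausdorff space; it is decomposable if it is the union of two of its proper subcontinua (subcontinua not equal to the whole space), and indecomposable otherwise. *)

theory Defs
  imports "HOL-Analysis.Analysis"
begin

section \<open>Coarse geometry\<close>

definition proper_metric :: "'a metric \<Rightarrow> bool" where
  "proper_metric X \<longleftrightarrow>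
     (\<forall>x \<in> mspace X. \<forall>r. compactin (mtopology_of X) (mcball_of X x r))"

definition bounded_in :: "'a metric \<Rightarrow> 'a set \<Rightarrow> bool" where
  "bounded_in X B \<longleftrightarrow> Metric_space.mbounded (mspace X) (mdist X) B"

definition coarse_map :: "'a metric \<Rightarrow> 'b metric \<Rightarrow> ('a \<Rightarrow> 'b) \<Rightarrow> bool" where
  "coarse_map X Y f \<longleftrightarrow>
     f \<in> mspace X \<rightarrow> mspace Y \<and>
     (\<exists>\<sigma> :: real \<Rightarrow> real. \<sigma> \<in> {0..} \<rightarrow> {0..} \<and> mono_on {0..} \<sigma> \<and>
        (\<forall>x \<in> mspace X. \<forall>x' \<in> mspace X. mdist Y (f x) (f x') \<le> \<sigma> (mdist X x x'))) \<and>
     (\<forall>B. bounded_in Y B \<longrightarrow> bounded_in X (f -` B \<inter> mspace X))"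

definition close_maps :: "'a metric \<Rightarrow> 'b metric \<Rightarrow> ('a \<Rightarrow> 'b) \<Rightarrow> ('a \<Rightarrow> 'b) \<Rightarrow> bool" where
  "close_maps X Y f g \<longleftrightarrow> (\<exists>r > 0. \<forall>x \<in> mspace X. mdist Y (f x) (g x) < r)"

definition coarse_equivalence :: "'a metric \<Rightarrow> 'b metric \<Rightarrow> ('a \<Rightarrow> 'b) \<Rightarrow> bool" where
  "coarse_equivalence X Y f \<longleftrightarrow>
     coarse_map X Y f \<and>
     (\<exists>g. coarse_map Y X g \<and> close_maps X X (g \<circ> f) id \<and> close_maps Y Y (f \<circ> g) id)"

definition coarsely_equivalent :: "'a metric \<Rightarrow> 'b metric \<Rightarrow> bool" where
  "coarsely_equivalent X Y \<longleftrightarrow> (\<exists>f. coarse_equivalence X Y f)"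

text \<open>Any two points are joined by an isometrically embedded interval.\<close>

definition geodesic_metric :: "'a metric \<Rightarrow> bool" where
  "geodesic_metric X \<longleftrightarrow>
     (\<forall>x \<in> mspace X. \<forall>y \<in> mspace X.
        \<exists>\<gamma> :: real \<Rightarrow> 'a. \<gamma> \<in> {0..mdist X x y} \<rightarrow> mspace X \<and>
          \<gamma> 0 = x \<and> \<gamma> (mdist X x y) = y \<and>
          (\<forall>s \<in> {0..mdist X x y}. \<forall>t \<in> {0..mdist X x y}. mdist X (\<gamma> s) (\<gamma> t) = \<bar>s - t\<bar>))"

text \<open>
  HOL cannot quantify existentially over types, so the type of the points of the geodesic
  space is a parameter. A theorem that assumes \<open>coarsely_geodesic TYPE('b) X\<close> with \<open>'b\<close> a free
  type variable holds for every \<open>'b\<close>, so it covers geodesic spaces of arbitrary cardinality.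
\<close>

definition coarsely_geodesic :: "'b itself \<Rightarrow> 'a metric \<Rightarrow> bool" where
  "coarsely_geodesic T X \<longleftrightarrow> (\<exists>Y :: 'b metric. geodesic_metric Y \<and> coarsely_equivalent X Y)"

definition net_in :: "'a metric \<Rightarrow> 'a set \<Rightarrow> bool" where
  "net_in X A \<longleftrightarrow>
     A \<subseteq> mspace X \<and> (\<exists>r > 0. \<forall>x \<in> mspace X. \<exists>a \<in> A. mdist X x a < r)"

text \<open>Finiteness is explicit because \<^const>\<open>card\<close> is 0 on infinite sets.\<close>

definition coarse_bounded_geometry :: "'a metric \<Rightarrow> bool" where
  "coarse_bounded_geometry X \<longleftrightarrow>
     (\<exists>A. \<exists>lam :: real \<Rightarrow> real. net_in X A \<and> lam \<in> {0..} \<rightarrow> {0..} \<and>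
        (\<forall>x \<in> mspace X. \<forall>t > 0.
           finite (A \<inter> mcball_of X x t) \<and> real (card (A \<inter> mcball_of X x t)) \<le> lam t))"

definition nat_metric :: "real metric" where
  "nat_metric = submetric euclidean_metric \<nat>"

section \<open>The Higson corona\<close>

text \<open>
  Functions on \<open>X\<close> are represented as elements of \<^term>\<open>extensional (mspace X)\<close>, so that each
  one occurs exactly once as an index of the product below.
\<close>

definition higson_functions :: "'a metric \<Rightarrow> ('a \<Rightarrow> real) set" where
  "higson_functions X =
     {f \<in> extensional (mspace X).
        continuous_map (mtopology_of X) euclideanreal f \<and>
        bounded (f ` mspace X) \<and>
        (\<forall>r > 0. \<forall>\<epsilon> > 0. \<exists>K. compactin (mtopology_of X) K \<and>
           (\<forall>x \<in> mspace X - K. diameter (f ` mcball_of X x r) < \<epsilon>))}"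

definition higson_product :: "'a metric \<Rightarrow> (('a \<Rightarrow> real) \<Rightarrow> real) topology" where
  "higson_product X =
     product_topology (\<lambda>f. top_of_set {Inf (f ` mspace X)..Sup (f ` mspace X)}) (higson_functions X)"

definition higson_eval :: "'a metric \<Rightarrow> 'a \<Rightarrow> ('a \<Rightarrow> real) \<Rightarrow> real" where
  "higson_eval X x = (\<lambda>f \<in> higson_functions X. f x)"

definition higson_compactification :: "'a metric \<Rightarrow> (('a \<Rightarrow> real) \<Rightarrow> real) topology" where
  "higson_compactification X =
     subtopology (higson_product X) (higson_product X closure_of (higson_eval X ` mspace X))"

definition higson_corona :: "'a metric \<Rightarrow> (('a \<Rightarrow> real) \<Rightarrow> real) topology" where
  "higson_corona X =
     subtopology (higson_compactification X)
       (topspace (higson_compactification X) - higson_eval X ` mspace X)"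

section \<open>Continua\<close>

definition continuum :: "'a topology \<Rightarrow> bool" where
  "continuum T \<longleftrightarrow>
     topspace T \<noteq> {} \<and> compact_space T \<and> connected_space T \<and> Hausdorff_space T"

definition subcontinuum :: "'a topology \<Rightarrow> 'a set \<Rightarrow> bool" where
  "subcontinuum T A \<longleftrightarrow> A \<subseteq> topspace T \<and> continuum (subtopology T A)"

definition decomposable :: "'a topology \<Rightarrow> bool" where
  "decomposable T \<longleftrightarrow>
     (\<exists>A B. subcontinuum T A \<and> subcontinuum T B \<and>
        A \<noteq> topspace T \<and> B \<noteq> topspace T \<and> A \<union> B = topspace T)"

definition indecomposable_continuum :: "'a topology \<Rightarrow> bool" where
  "indecomposable_continuum T \<longleftrightarrow> continuum T \<and> \<not> decomposable T"

end

theory Submission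
  imports Defs
begin

text \<open>
  Subsets \<open>S\<close> of \<open>X\<close> are studied through their traces on the corona, the points of \<open>\<nu>X\<close> in the
  closure of \<open>S\<close>. Coarsely disjoint sets have disjoint traces, and a separation of a trace comes
  from a Higson function that is negative or larger than 1 on \<open>S\<close> up to a bounded set.

  If \<open>X\<close> is coarsely equivalent to \<open>\<nat>\<close>, let \<open>A\<close> be a proper closed subset of \<open>\<nu>X\<close> with nonempty
  interior. A Higson function negative on \<open>A\<close> exceeds 1 on an unbounded sequence of points;
  these cut the ray into blocks, and collecting the even and the odd blocks disconnects \<open>A\<close>.

  Conversely, let \<open>\<nu>X\<close> be a continuum. A net in \<open>X\<close> is a locally finite connected graph because
  \<open>X\<close> is coarsely geodesic, and it is one-ended because \<open>\<nu>X\<close> is connected. If it lies near a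
  geodesic ray, then \<open>X\<close> is coarsely equivalent to \<open>\<nat>\<close>. Otherwise infinitely many larger and larger
  balls off the ray, enlarged by the vertices that they cut off from infinity, can be removed so
  sparsely that the remaining set \<open>Z\<close> is one-ended. The trace of \<open>Z\<close> is then a proper subcontinuum
  with nonempty interior, and a continuum that contains one is decomposable.
\<close>

section \<open>Decomposing a continuum\<close>

text \<open>The interval between 0 and 1 turns topology into combinatorics: far out, a Higson
  function changes by less than 1 over a bounded distance, so it cannot pass from negative values to
  values above 1 in one bounded step without taking a value in the gap. If only a bounded set has
  values in the gap, a separation of a trace becomes a cut by finitely many edges, and conversely.
  The obstacle is to remove infinitely many balls without creating new ends. A ball may cut off a
  finite pocket; infinitely many pockets would be infinitely many finite components, and half of
  them could be separated from the rest without any edge. Filling the pockets leaves a hole whose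
  outer boundary is connected off the hole, by paths in a bounded annulus that later holes avoid. A
  finite cut of what remains then extends over almost all holes to a finite cut of the whole graph.
  The ray marks the unbounded component. A ball that misses the ray cannot cut off its tail, so the
  only obstruction to finding holes of every size is that the whole net lies within a bounded
  distance of the ray.\<close>

lemma subcontinuumI:
  assumes "compact_space T" "Hausdorff_space T" "closedin T C" "connectedin T C" "C \<noteq> {}"
  shows "subcontinuum T C"
  using assms closedin_subset[OF assms(3)] closedin_compact_space[OF assms(1,3)]
  by (auto simp: subcontinuum_def continuum_def Hausdorff_space_subtopology
      compact_space_subtopology connectedin_def inf_absorb2)

text \<open>In a separation of \<open>C \<union> O1\<close> the connected set \<open>C\<close> lies
  in one half, so the other half stays inside \<open>O1\<close>. Its complement is then the first
  half together with \<open>C \<union> O2\<close>, a union of two closed sets. The assumption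
  \<open>ne\<close> rules out that this other half is the whole space.\<close>

lemma connectedin_Un_complement_part:
  assumes T: "connected_space T" and C: "connectedin T C"
    and O1: "openin T O1" and O2: "openin T O2" and disj: "O1 \<inter> O2 = {}"
    and cover: "topspace T - C = O1 \<union> O2" and ne: "O2 \<noteq> {} \<or> C \<noteq> {}"
  shows "connectedin T (C \<union> O1)"
proof -
  have Csub: "C \<subseteq> topspace T" using C connectedin_subset_topspace by blast
  have O1sub: "O1 \<subseteq> topspace T" and O2sub: "O2 \<subseteq> topspace T"
    using O1 O2 openin_subset by auto
  have eq: "C \<union> O1 = topspace T - O2" using cover disj Csub O1sub by blast
  have cl1: "closedin T (C \<union> O1)" unfolding eq using O2 by blast
  have eq2: "C \<union> O2 = topspace T - O1" using cover disj Csub O2sub by blast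
  have cl2: "closedin T (C \<union> O2)" unfolding eq2 using O1 by blast
  have key: False
    if K: "closedin T K1" "closedin T K2" "C \<union> O1 \<subseteq> K1 \<union> K2" "K1 \<inter> K2 \<inter> (C \<union> O1) = {}"
      "K1 \<inter> (C \<union> O1) \<noteq> {}" "K2 \<inter> (C \<union> O1) \<noteq> {}" "C \<subseteq> K1" for K1 K2
  proof -
    \<comment> \<open>\<open>L\<close> misses \<open>C\<close>, so it is open and closed in the whole space.\<close>
    define L where "L = K2 \<inter> (C \<union> O1)"
    have L1: "closedin T L" unfolding L_def using K(2) cl1 by blast
    have LO: "L \<subseteq> O1" using K(4,7) by (auto simp: L_def)
    have L2: "topspace T - L = (K1 \<inter> (C \<union> O1)) \<union> (C \<union> O2)"
      using cover disj K(3,4) LO Csub O1sub O2sub by (auto simp: L_def)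
    have "closedin T (topspace T - L)" unfolding L2 using K(1) cl1 cl2 by blast
    then have "openin T L" using L1 closedin_subset openin_closedin_eq by (metis double_diff order_refl)
    with L1 T have "L = {} \<or> L = topspace T" by (simp add: connected_space_clopen_in)
    then show False using K(6) LO ne disj cover Csub O2sub by (auto simp: L_def)
  qed
  show ?thesis unfolding connectedin_closedin
  proof (intro conjI notI)
    show "C \<union> O1 \<subseteq> topspace T" using Csub O1sub by blast
    assume "\<exists>K1 K2. closedin T K1 \<and> closedin T K2 \<and> C \<union> O1 \<subseteq> K1 \<union> K2 \<and> K1 \<inter> K2 \<inter> (C \<union> O1) = {} \<and>
      K1 \<inter> (C \<union> O1) \<noteq> {} \<and> K2 \<inter> (C \<union> O1) \<noteq> {}"
    then obtain K1 K2 where K: "closedin T K1" "closedin T K2" "C \<union> O1 \<subseteq> K1 \<union> K2"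
      "K1 \<inter> K2 \<inter> (C \<union> O1) = {}" "K1 \<inter> (C \<union> O1) \<noteq> {}" "K2 \<inter> (C \<union> O1) \<noteq> {}" by blast
    have "C \<subseteq> K1 \<or> C \<subseteq> K2"
    proof (rule ccontr)
      assume "\<not> (C \<subseteq> K1 \<or> C \<subseteq> K2)"
      then have "K1 \<inter> C \<noteq> {}" "K2 \<inter> C \<noteq> {}" "C \<subseteq> K1 \<union> K2" "K1 \<inter> K2 \<inter> C = {}"
        using K(3,4) by auto
      then show False using C K(1,2) unfolding connectedin_closedin by blast
    qed
    then show False
      using key[of K1 K2] key[of K2 K1] K by (auto simp: Un_commute Int_commute)
  qed
qed

text \<open>If the complement of \<open>C\<close> is connected, its closure misses \<open>U\<close>
  and serves as the second subcontinuum. Otherwise the complement splits into two open pieces, and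
  \<open>C\<close> joined with each of them in turn gives the decomposition.\<close>

lemma decomposableI:
  assumes T: "continuum T" and C: "subcontinuum T C" "C \<noteq> topspace T"
    and U: "openin T U" "U \<noteq> {}" "U \<subseteq> C"
  shows "decomposable T"
proof -
  have conT: "connected_space T" and compT: "compact_space T" and HT: "Hausdorff_space T"
    using T by (auto simp: continuum_def)
  have Csub: "C \<subseteq> topspace T" and conC: "connectedin T C" and compC: "compactin T C"
    using C(1) by (auto simp: subcontinuum_def continuum_def connectedin_def compactin_subspace)
  have clC: "closedin T C" using compC HT compactin_imp_closedin by blast
  have opR: "openin T (topspace T - C)" using clC by blast
  have neR: "topspace T - C \<noteq> {}" using C(2) Csub by blast
  have neC: "C \<noteq> {}" using U by blast
  show ?thesis
  proof (cases "connectedin T (topspace T - C)")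
    case True
    define B where "B = T closure_of (topspace T - C)"
    have RB: "topspace T - C \<subseteq> B" unfolding B_def by (simp add: closure_of_subset)
    have "subcontinuum T B"
      using subcontinuumI[OF compT HT, of B] RB neR True
      by (auto simp: B_def connectedin_closure_of)
    moreover have "B \<subseteq> topspace T - U"
      unfolding B_def by (rule closure_of_minimal) (use U in auto)
    then have "B \<noteq> topspace T" using U openin_subset by fastforce
    moreover have "C \<union> B = topspace T"
      using RB Csub closure_of_subset_topspace[of T] by (auto simp: B_def)
    ultimately show ?thesis unfolding decomposable_def using C by blast
  next
    case False
    then obtain E1 E2 where E: "openin T E1" "openin T E2" "topspace T - C \<subseteq> E1 \<union> E2"
      "E1 \<inter> E2 \<inter> (topspace T - C) = {}" "E1 \<inter> (topspace T - C) \<noteq> {}" "E2 \<inter> (topspace T - C) \<noteq> {}"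
      unfolding connectedin by blast
    define O1 where "O1 = E1 \<inter> (topspace T - C)"
    define O2 where "O2 = E2 \<inter> (topspace T - C)"
    have O: "openin T O1" "openin T O2" "O1 \<inter> O2 = {}" "topspace T - C = O1 \<union> O2" "O1 \<noteq> {}" "O2 \<noteq> {}"
      using E opR by (auto simp: O1_def O2_def)
    have O': "O2 \<inter> O1 = {}" "topspace T - C = O2 \<union> O1" using O by auto
    have c1: "connectedin T (C \<union> O1)"
      using connectedin_Un_complement_part[OF conT conC O(1-4)] neC by blast
    have c2: "connectedin T (C \<union> O2)"
      using connectedin_Un_complement_part[OF conT conC O(2,1) O'] neC by blast
    have eq: "C \<union> O1 = topspace T - O2" "C \<union> O2 = topspace T - O1"
      using O Csub openin_subset[OF O(1)] openin_subset[OF O(2)] by blast+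
    have "closedin T (C \<union> O1)" "closedin T (C \<union> O2)" unfolding eq using O(1,2) by auto
    then have "subcontinuum T (C \<union> O1)" "subcontinuum T (C \<union> O2)"
      using subcontinuumI[OF compT HT] c1 c2 neC by auto
    moreover have "C \<union> O1 \<noteq> topspace T" "C \<union> O2 \<noteq> topspace T"
      using eq O(5,6) openin_subset[OF O(1)] openin_subset[OF O(2)] by blast+
    moreover have "(C \<union> O1) \<union> (C \<union> O2) = topspace T" using O(4) Csub by blast
    ultimately show ?thesis unfolding decomposable_def by blast
  qed
qed

section \<open>One-ended locally finite graphs\<close>

locale loc_fin_graph =
  fixes V :: "'a set" and E :: "'a \<Rightarrow> 'a \<Rightarrow> bool"
  assumes E_in: "E x y \<Longrightarrow> x \<in> V \<and> y \<in> V"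
    and E_sym: "E x y \<Longrightarrow> E y x"
    and E_fin: "finite {y. E x y}"
    and E_conn: "x \<in> V \<Longrightarrow> y \<in> V \<Longrightarrow> E\<^sup>*\<^sup>* x y"
    and V_inf: "infinite V"
begin

definition gdist :: "'a \<Rightarrow> 'a \<Rightarrow> nat" where
  "gdist x y = (LEAST n. (E ^^ n) x y)"

definition gball :: "'a \<Rightarrow> nat \<Rightarrow> 'a set" where
  "gball x n = {y \<in> V. gdist x y \<le> n}"

text \<open>Both ends of every edge lie in \<open>W\<close>, but the closure is reflexive:
  \<open>reach W x x\<close> holds for \<open>x\<close> outside \<open>W\<close> as well, so
  membership in \<open>W\<close> has to be tracked separately.\<close>

definition reach :: "'a set \<Rightarrow> 'a \<Rightarrow> 'a \<Rightarrow> bool" where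
  "reach W = (\<lambda>u v. E u v \<and> u \<in> W \<and> v \<in> W)\<^sup>*\<^sup>*"

definition bdry :: "'a set \<Rightarrow> 'a set" where
  "bdry D = {p. \<exists>v \<in> D. E v p} - D"

text \<open>Ends are counted by finite edge cuts of the induced graph, because this is what a Higson
  function with bounded gap produces. The induced graph need not be connected: finitely many finite
  components are harmless.\<close>

definition one_ended :: "'a set \<Rightarrow> bool" where
  "one_ended Z \<longleftrightarrow> (\<forall>P \<subseteq> Z. infinite P \<longrightarrow> infinite (Z - P) \<longrightarrow>
     infinite {(p, q). p \<in> P \<and> q \<in> Z - P \<and> E p q})"

section \<open>Graph distance and its finite balls\<close>

lemma relpowp_gdist:
  assumes "x \<in> V" "y \<in> V" shows "(E ^^ gdist x y) x y"
proof -
  obtain n where "(E ^^ n) x y"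
    using E_conn[OF assms] by (meson rtranclp_imp_relpowp)
  then show ?thesis unfolding gdist_def by (rule LeastI)
qed

lemma gdist_le: "(E ^^ n) x y \<Longrightarrow> gdist x y \<le> n"
  unfolding gdist_def by (rule Least_le)

lemma gdist_self [simp]: "gdist x x = 0"
  using gdist_le[of 0 x x] by simp

lemma gdist_edge: "E x y \<Longrightarrow> gdist x y \<le> 1"
  by (rule gdist_le) auto

lemma relpowp_sym: "(E ^^ n) x y \<Longrightarrow> (E ^^ n) y x"
proof (induction n arbitrary: y)
  case (Suc n)
  then obtain z where "(E ^^ n) x z" "E z y" by auto
  then show ?case using Suc.IH E_sym by (meson relpowp_Suc_I2)
qed auto

lemma gdist_sym: "x \<in> V \<Longrightarrow> y \<in> V \<Longrightarrow> gdist x y = gdist y x"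
  by (meson antisym gdist_le relpowp_gdist relpowp_sym)

lemma gdist_triangle:
  assumes "x \<in> V" "y \<in> V" "z \<in> V"
  shows "gdist x z \<le> gdist x y + gdist y z"
  by (rule gdist_le) (use assms relpowp_gdist relpowp_trans in metis)

lemma gdist_edge_le:
  assumes "x \<in> V" "E y z" shows "gdist x z \<le> gdist x y + 1"
  using gdist_triangle[of x y z] gdist_edge[OF assms(2)] E_in[OF assms(2)] assms(1) by linarith

lemma gdist_zeroD: "x \<in> V \<Longrightarrow> y \<in> V \<Longrightarrow> gdist x y = 0 \<Longrightarrow> x = y"
  using relpowp_gdist[of x y] by simp

lemma finite_relpowp: "finite {y. (E ^^ n) x y}"
proof (induction n)
  case (Suc n)
  have "{y. (E ^^ Suc n) x y} = (\<Union>z \<in> {y. (E ^^ n) x y}. {y. E z y})" by auto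
  then show ?case using Suc E_fin by auto
qed auto

lemma finite_gball [simp]: assumes "x \<in> V" shows "finite (gball x n)"
proof (rule finite_subset)
  show "gball x n \<subseteq> (\<Union>k \<le> n. {y. (E ^^ k) x y})"
    unfolding gball_def using relpowp_gdist[OF assms] by blast
qed (simp add: finite_relpowp)

lemma gball_mono: "m \<le> n \<Longrightarrow> gball x m \<subseteq> gball x n"
  by (auto simp: gball_def)

lemma gball_subset: "gball x n \<subseteq> V"
  by (auto simp: gball_def)

lemma gball_edge:
  assumes "x \<in> V" "E y z" "y \<in> gball x n" shows "z \<in> gball x (Suc n)"
  using gdist_edge_le[OF assms(1,2)] E_in[OF assms(2)] assms(3) by (auto simp: gball_def)

lemma finite_subset_gball:
  assumes "finite S" "S \<subseteq> V"
  shows "\<exists>N. S \<subseteq> gball x N"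
proof -
  have "S \<subseteq> gball x (Max (gdist x ` S))"
    using assms by (auto simp: gball_def)
  then show ?thesis by blast
qed

lemma finite_bdry: "finite D \<Longrightarrow> finite (bdry D)"
proof -
  assume "finite D"
  moreover have "bdry D \<subseteq> (\<Union>v \<in> D. {p. E v p})" by (auto simp: bdry_def)
  ultimately show ?thesis using E_fin by (meson finite_UN finite_subset)
qed

section \<open>Paths inside a set of vertices\<close>

lemma reach_refl [simp]: "reach W x x"
  by (simp add: reach_def)

lemma reach_trans: "reach W x y \<Longrightarrow> reach W y z \<Longrightarrow> reach W x z"
  by (simp add: reach_def)

lemma reach_sym: "reach W x y \<Longrightarrow> reach W y x"
  unfolding reach_def
proof (induction rule: rtranclp_induct)
  case (step y z)
  then show ?case using E_sym by (metis (no_types, lifting) converse_rtranclp_into_rtranclp)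
qed simp

lemma reach_mono: "reach W x y \<Longrightarrow> W \<subseteq> W' \<Longrightarrow> reach W' x y"
  unfolding reach_def by (erule rtranclp_mono[THEN predicate2D, rotated]) auto

lemma reach_in: "reach W x y \<Longrightarrow> x \<in> W \<Longrightarrow> y \<in> W"
  unfolding reach_def by (induction rule: rtranclp_induct) auto

lemma reach_step: "reach W x y \<Longrightarrow> E y z \<Longrightarrow> y \<in> W \<Longrightarrow> z \<in> W \<Longrightarrow> reach W x z"
  unfolding reach_def by (simp add: rtranclp.rtrancl_into_rtrancl)

lemma reach_component: "reach W x y \<Longrightarrow> reach {z. reach W x z} x y"
  unfolding reach_def[of W]
proof (induction rule: rtranclp_induct)
  case (step y z)
  have y: "reach W x y" using step(1) by (simp add: reach_def)
  have z: "reach W x z" using reach_step[OF y] step(2) by blast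
  show ?case using reach_step[of "{z. reach W x z}" x y z] step y z
    by (simp add: reach_def)
qed simp

lemma reach_finite_range:
  assumes "reach W x y" "W \<subseteq> V"
  shows "\<exists>N. reach (W \<inter> gball a N) x y"
  using assms(1) unfolding reach_def[of W]
proof (induction rule: rtranclp_induct)
  case (step y z)
  then obtain N where N: "reach (W \<inter> gball a N) x y" by blast
  obtain N' where N': "{y, z} \<subseteq> gball a N'"
    using finite_subset_gball[of "{y, z}"] step(2) E_in by blast
  have "reach (W \<inter> gball a (max N N')) x y"
    by (rule reach_mono[OF N]) (use gball_mono[of N "max N N'"] in auto)
  moreover have "y \<in> gball a (max N N')" "z \<in> gball a (max N N')"
    using N' gball_mono[of N' "max N N'" a] by auto
  ultimately show ?case using reach_step step(2) by blast
qed auto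

lemma reach_finite_range_set:
  assumes "finite S" "\<And>s. s \<in> S \<Longrightarrow> reach W x s" "W \<subseteq> V"
  shows "\<exists>N. \<forall>s \<in> S. reach (W \<inter> gball a N) x s"
  using assms(1,2)
proof (induction S)
  case (insert s S)
  then obtain N where N: "\<forall>s \<in> S. reach (W \<inter> gball a N) x s" by blast
  obtain N' where N': "reach (W \<inter> gball a N') x s"
    using reach_finite_range insert.prems assms(3) by blast
  have sub: "W \<inter> gball a N \<subseteq> W \<inter> gball a (max N N')" "W \<inter> gball a N' \<subseteq> W \<inter> gball a (max N N')"
    using gball_mono[of N "max N N'" a] gball_mono[of N' "max N N'" a] by auto
  have "\<forall>t \<in> insert s S. reach (W \<inter> gball a (max N N')) x t"
    using N N' sub reach_mono by blast
  then show ?case by blast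
qed auto

section \<open>Geodesic rays and the removal of balls\<close>

text \<open>Konig's lemma. \<open>beyond v\<close> collects the vertices that a geodesic from
  \<open>a\<close> reaches through \<open>v\<close>; if it is infinite, so is
  \<open>beyond v'\<close> for one of the finitely many neighbours \<open>v'\<close> that are one
  step further from \<open>a\<close>.\<close>

lemma exists_ray:
  assumes "a \<in> V"
  shows "\<exists>\<gamma>. \<gamma> 0 = a \<and> (\<forall>n. \<gamma> n \<in> V \<and> gdist a (\<gamma> n) = n \<and> E (\<gamma> n) (\<gamma> (Suc n)))"
proof -
  define beyond where "beyond v = {w \<in> V. gdist a w = gdist a v + gdist v w}" for v
  define T where "T n v \<longleftrightarrow> v \<in> V \<and> infinite (beyond v) \<and> gdist a v = n" for n v
  have step: "\<exists>v'. T (Suc n) v' \<and> E v v'" if "T n v" for n v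
  proof -
    have v: "v \<in> V" "infinite (beyond v)" "gdist a v = n" using that by (auto simp: T_def)
    have "beyond v - {v} \<subseteq> (\<Union>v' \<in> {v'. E v v' \<and> gdist a v' = Suc n}. beyond v')"
    proof
      fix w assume w: "w \<in> beyond v - {v}"
      then have wV: "w \<in> V" "gdist a w = n + gdist v w" "gdist v w \<noteq> 0"
        using v gdist_zeroD by (auto simp: beyond_def)
      then obtain k where k: "gdist v w = Suc k" using not0_implies_Suc by blast
      then obtain v' where v': "E v v'" "(E ^^ k) v' w"
        using relpowp_gdist[OF v(1) wV(1)] by (metis relpowp_Suc_D2)
      have "gdist v' w \<le> k" using gdist_le v'(2) .
      moreover have "gdist a v' \<le> Suc n" using gdist_edge_le[OF assms v'(1)] v by simp
      moreover have "gdist a w \<le> gdist a v' + gdist v' w"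
        using gdist_triangle assms E_in[OF v'(1)] wV by blast
      ultimately have "gdist a v' = Suc n" "gdist a w = gdist a v' + gdist v' w"
        using wV k by auto
      then show "w \<in> (\<Union>v' \<in> {v'. E v v' \<and> gdist a v' = Suc n}. beyond v')"
        using v'(1) wV(1) by (auto simp: beyond_def)
    qed
    moreover have "infinite (beyond v - {v})" using v by simp
    moreover have "finite {v'. E v v' \<and> gdist a v' = Suc n}" using E_fin[of v] by simp
    ultimately obtain v' where "E v v'" "gdist a v' = Suc n" "infinite (beyond v')"
      by (metis (mono_tags, lifting) finite_UN_I finite_subset mem_Collect_eq)
    then show ?thesis using E_in by (auto simp: T_def)
  qed
  have T0: "T 0 a" using assms V_inf by (auto simp: T_def beyond_def)
  obtain \<gamma> where g: "\<forall>n. T n (\<gamma> n)" "\<forall>n. E (\<gamma> n) (\<gamma> (Suc n))"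
    using dependent_nat_choice[of T "\<lambda>_. E"] T0 step by metis
  have "\<gamma> 0 = a" using g(1) gdist_zeroD[OF assms, of "\<gamma> 0"] by (auto simp: T_def)
  then show ?thesis using g by (intro exI[of _ \<gamma>]) (auto simp: T_def)
qed

text \<open>An edge leaving the component of the tail must end in \<open>K\<close>, so this
  component has a finite cut. It is infinite, as the ray is injective, hence its complement is
  finite.\<close>

lemma finite_compl_tail_component:
  assumes oe: "one_ended V" and K: "finite K"
    and \<gamma>: "\<And>n. E (\<gamma> n) (\<gamma> (Suc n))" "inj \<gamma>" "\<And>k. k \<ge> m \<Longrightarrow> \<gamma> k \<notin> K"
  shows "finite (V - {y. reach (V - K) (\<gamma> m) y})"
proof (rule ccontr)
  define P where "P = {y. reach (V - K) (\<gamma> m) y}"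
  assume "infinite (V - {y. reach (V - K) (\<gamma> m) y})"
  then have Q: "infinite (V - P)" by (simp add: P_def)
  have \<gamma>V: "\<gamma> n \<in> V" for n using E_in \<gamma>(1) by blast
  have PV: "P \<subseteq> V - K" using reach_in \<gamma>(3)[of m] \<gamma>V by (auto simp: P_def)
  have tail: "\<gamma> (m + k) \<in> P" for k
  proof (induction k)
    case (Suc k)
    then show ?case using reach_step[of "V - K" "\<gamma> m" "\<gamma> (m + k)"] \<gamma> \<gamma>V by (simp add: P_def)
  qed (simp add: P_def)
  have "infinite (range (\<lambda>k. \<gamma> (m + k)))"
    using \<gamma>(2) by (intro range_inj_infinite) (meson add_left_imp_eq injD injI)
  then have "infinite P" using tail by (meson finite_subset image_subsetI)
  with oe Q PV have "infinite {(p, q). p \<in> P \<and> q \<in> V - P \<and> E p q}"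
    unfolding one_ended_def by blast
  moreover have "{(p, q). p \<in> P \<and> q \<in> V - P \<and> E p q} \<subseteq> (\<Union>q \<in> K. {p. E q p} \<times> {q})"
  proof clarify
    fix p q assume pq: "p \<in> P" "q \<in> V" "q \<notin> P" "E p q"
    then have "q \<in> K"
      using reach_step[of "V - K" "\<gamma> m" p q] PV by (auto simp: P_def)
    then show "(p, q) \<in> (\<Union>q \<in> K. {p. E q p} \<times> {q})" using E_sym pq by auto
  qed
  moreover have "finite (\<Union>q \<in> K. {p. E q p} \<times> {q})" using K E_fin by auto
  ultimately show False using finite_subset by blast
qed

text \<open>
  The hole \<open>D\<close> consists of the ball \<open>K\<close> around \<open>x\<close> and of what \<open>K\<close> together with the ball \<open>B\<close>
  around \<open>a\<close>, but not \<open>B\<close> alone, cuts off from the tail of the ray. Its boundary lies in the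
  component \<open>W\<close> of that tail, so it is connected outside \<open>B\<close> and outside \<open>D\<close>.
\<close>

lemma exists_hole:
  assumes oe: "one_ended V" and aV: "a \<in> V"
    and \<gamma>: "\<gamma> 0 = a" "\<And>n. gdist a (\<gamma> n) = n" "\<And>n. E (\<gamma> n) (\<gamma> (Suc n))"
    and far: "\<And>n. \<exists>x \<in> V. \<forall>k. n < gdist x (\<gamma> k)"
  shows "\<exists>D M' x y. M < M' \<and> D \<subseteq> gball a M' \<and> D \<inter> gball a (Suc M) = {} \<and>
    x \<in> V \<and> gball x n \<subseteq> D \<and> y \<in> V \<and> gball y n \<subseteq> gball a M' - gball a M - D \<and>
    (\<forall>p \<in> bdry D. \<forall>q \<in> bdry D. reach (gball a M' - gball a M - D) p q)"
proof -
  have \<gamma>V: "\<gamma> n \<in> V" for n using E_in \<gamma>(3) by blast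
  have inj: "inj \<gamma>" using \<gamma>(2) by (metis injI)
  define B where "B = gball a M"
  define g where "g = \<gamma> (Suc M)"
  define U where "U = {y. reach (V - B) g y}"
  have gB: "\<gamma> k \<notin> B" if "k \<ge> Suc M" for k using that \<gamma>(2)[of k] by (auto simp: B_def gball_def)
  have finB: "finite B" using aV by (simp add: B_def)
  have cofU: "finite (V - U)"
    unfolding U_def g_def using finite_compl_tail_component[OF oe finB \<gamma>(3) inj] gB by blast
  have UV: "U \<subseteq> V - B" using reach_in[of "V - B" g] gB[of "Suc M"] \<gamma>V by (auto simp: U_def g_def)
  \<comment> \<open>Paths from \<open>g\<close> to the part of \<open>U\<close> in the layer just
    outside \<open>B\<close> are confined to radius \<open>N1\<close>. The ball \<open>K\<close> is
    placed beyond that radius, so they survive its removal, and this keeps \<open>D\<close> off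
    \<open>gball a (Suc M)\<close>.\<close>
  have "finite (U \<inter> gball a (Suc M))" using aV by simp
  moreover have "\<And>s. s \<in> U \<inter> gball a (Suc M) \<Longrightarrow> reach (V - B) g s" by (simp add: U_def)
  ultimately obtain N1 where N1: "\<forall>s \<in> U \<inter> gball a (Suc M). reach ((V - B) \<inter> gball a N1) g s"
    using reach_finite_range_set[of _ "V - B" g a] by blast
  obtain N2 where N2: "V - U \<subseteq> gball a N2" using finite_subset_gball[OF cofU] by blast
  define N where "N = max N1 N2"
  \<comment> \<open>The case \<open>k = 0\<close> puts \<open>K\<close> outside
    \<open>gball a N\<close>, so that it avoids those paths and lies in \<open>U\<close>; the other
    \<open>k\<close> keep the ray off \<open>K\<close>.\<close>
  obtain x where x: "x \<in> V" "\<And>k. n + N < gdist x (\<gamma> k)" using far by blast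
  define K where "K = gball x n"
  have KN: "K \<inter> gball a N = {}"
  proof -
    { fix y assume "y \<in> K" "y \<in> gball a N"
      then have "y \<in> V" "gdist x y \<le> n" "gdist a y \<le> N" by (auto simp: K_def gball_def)
      then have "gdist x a \<le> n + N"
        using gdist_triangle[of x y a] gdist_sym[of y a] x(1) aV by simp
      then have False using x(2)[of 0] \<gamma>(1) by simp }
    then show ?thesis by blast
  qed
  have gK: "\<gamma> k \<notin> K" for k using x(2)[of k] by (auto simp: K_def gball_def)
  have finK: "finite (B \<union> K)" using finB x(1) by (simp add: K_def)
  define W where "W = {y. reach (V - (B \<union> K)) g y}"
  have cofW: "finite (V - W)"
    unfolding W_def g_def using finite_compl_tail_component[OF oe finK \<gamma>(3) inj] gB gK by blast
  have WV: "W \<subseteq> V - (B \<union> K)"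
    using reach_in[of "V - (B \<union> K)" g] gB[of "Suc M"] \<gamma>V gK by (auto simp: W_def g_def)
  define D where "D = U - W"
  have KD: "K \<subseteq> D"
  proof
    fix y assume y: "y \<in> K"
    then have "y \<in> V" "y \<notin> gball a N2"
      using KN gball_mono[of N2 N a] gball_subset[of x n] by (auto simp: K_def N_def)
    then have "y \<in> U" using N2 by blast
    then show "y \<in> D" using y WV by (auto simp: D_def)
  qed
  have finD: "finite D" using finite_subset[OF _ cofW, of D] UV by (auto simp: D_def)
  have DV: "D \<subseteq> V" using UV by (auto simp: D_def)
  have Dball: "D \<inter> gball a (Suc M) = {}"
  proof -
    { fix s assume s: "s \<in> U" "s \<in> gball a (Suc M)"
      have "(V - B) \<inter> gball a N1 \<subseteq> V - (B \<union> K)"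
        using KN gball_mono[of N1 N a] by (auto simp: N_def)
      then have "reach (V - (B \<union> K)) g s" using N1 s reach_mono by blast
      then have "s \<in> W" by (simp add: W_def) }
    then show ?thesis by (auto simp: D_def)
  qed
  \<comment> \<open>A neighbour of \<open>D\<close> is outside \<open>B\<close> because of the free
    layer of radius \<open>Suc M\<close>. So it still belongs to \<open>U\<close>, and being outside
    \<open>D\<close> it belongs to \<open>W\<close>.\<close>
  have bd: "bdry D \<subseteq> W"
  proof
    fix p assume "p \<in> bdry D"
    then obtain v where v: "v \<in> D" "E v p" "p \<notin> D" by (auto simp: bdry_def)
    have "p \<notin> B"
      using gball_edge[OF aV E_sym[OF v(2)]] Dball v(1) by (auto simp: B_def)
    then have "p \<in> U"
      using reach_step[of "V - B" g v p] v E_in[OF v(2)] UV by (auto simp: U_def D_def)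
    then show "p \<in> W" using v by (auto simp: D_def)
  qed
  have "\<And>s. s \<in> bdry D \<Longrightarrow> reach W g s"
    using bd reach_component by (auto simp: W_def)
  then obtain N3 where N3: "\<forall>s \<in> bdry D. reach (W \<inter> gball a N3) g s"
    using reach_finite_range_set[of "bdry D" W g a] finite_bdry[OF finD] WV by blast
  obtain N4 where N4: "B \<union> D \<subseteq> gball a N4"
    using finite_subset_gball[of "B \<union> D" a] finB finD DV gball_subset by (auto simp: B_def)
  \<comment> \<open>The margin \<open>n\<close> beyond \<open>B\<close> and \<open>D\<close> leaves
    room for an intact ball around \<open>y\<close>. The outer radius \<open>M'\<close> is chosen to
    contain this ball, the hole, and the paths that join its boundary.\<close>
  have "\<not> V \<subseteq> gball a (N4 + n)" using V_inf aV finite_subset finite_gball by blast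
  then obtain y where "y \<in> V" "y \<notin> gball a (N4 + n)" by blast
  then have y: "y \<in> V" "gdist a y > N4 + n" by (auto simp: gball_def)
  define M' where "M' = Max {Suc M, N3, N4, gdist a y + n}"
  have M': "Suc M \<le> M'" "N3 \<le> M'" "N4 \<le> M'" "gdist a y + n \<le> M'" by (auto simp: M'_def)
  have yball: "gball y n \<subseteq> gball a M' - gball a M - D"
  proof
    fix z assume z: "z \<in> gball y n"
    then have zV: "z \<in> V" "gdist y z \<le> n" by (auto simp: gball_def)
    have "gdist a z \<le> gdist a y + gdist y z" "gdist a y \<le> gdist a z + gdist z y"
      using gdist_triangle zV y aV by auto
    then have "gdist a z \<le> M'" "gdist a z > N4" using zV y M' gdist_sym[of y z] by auto
    then have "z \<in> gball a M'" "z \<notin> gball a N4" using zV by (auto simp: gball_def)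
    then show "z \<in> gball a M' - gball a M - D" using N4 by (auto simp: B_def)
  qed
  have sub: "W \<inter> gball a N3 \<subseteq> gball a M' - gball a M - D"
    using WV gball_mono[OF M'(2), of a] by (auto simp: D_def B_def)
  have "reach (gball a M' - gball a M - D) p q" if "p \<in> bdry D" "q \<in> bdry D" for p q
    using N3 that reach_mono[OF _ sub] reach_sym reach_trans by blast
  moreover have "D \<subseteq> gball a M'" using N4 gball_mono[OF M'(3), of a] by auto
  ultimately show ?thesis
    using M'(1) Dball x(1) KD y(1) yball unfolding K_def
    by (intro exI[of _ D] exI[of _ M'] exI[of _ x] exI[of _ y]) auto
qed

text \<open>Each hole owns the annulus between the radii \<open>m n\<close> and
  \<open>m (Suc n)\<close>, which also contains the paths joining the boundary of the hole and an
  intact ball of radius \<open>n\<close>. Holes chosen later therefore destroy neither.\<close>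

lemma exists_one_ended_with_holes:
  assumes oe: "one_ended V" and aV: "a \<in> V"
    and \<gamma>: "\<gamma> 0 = a" "\<And>n. gdist a (\<gamma> n) = n" "\<And>n. E (\<gamma> n) (\<gamma> (Suc n))"
    and far: "\<And>n. \<exists>x \<in> V. \<forall>k. n < gdist x (\<gamma> k)"
  shows "\<exists>Z x y. Z \<subseteq> V \<and> one_ended Z \<and>
    (\<forall>n. x n \<in> V \<and> n < gdist a (x n) \<and> gball (x n) n \<inter> Z = {}) \<and>
    (\<forall>n. y n \<in> V \<and> n < gdist a (y n) \<and> gball (y n) n \<subseteq> Z)"
proof -
  define good where "good n M D M' x y \<longleftrightarrow> M < M' \<and> D \<subseteq> gball a M' \<and> D \<inter> gball a (Suc M) = {} \<and>
    x \<in> V \<and> gball x n \<subseteq> D \<and> y \<in> V \<and> gball y n \<subseteq> gball a M' - gball a M - D \<and>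
    (\<forall>p \<in> bdry D. \<forall>q \<in> bdry D. reach (gball a M' - gball a M - D) p q)" for n M D M' x y
  have "\<forall>n M. \<exists>D M' x y. good n M D M' x y"
    unfolding good_def using exists_hole[OF oe aV \<gamma> far] by blast
  then obtain fD fM fx fy where f: "\<And>n M. good n M (fD n M) (fM n M) (fx n M) (fy n M)"
    by metis
  define m where "m = rec_nat 0 fM"
  define D where "D n = fD n (m n)" for n
  define x where "x n = fx n (m n)" for n
  define y where "y n = fy n (m n)" for n
  have good: "good n (m n) (D n) (m (Suc n)) (x n) (y n)" for n
    using f[of n "m n"] by (simp add: D_def x_def y_def m_def)
  have "strict_mono m" using good by (simp add: good_def strict_mono_Suc_iff)
  then have m_mono: "i \<le> j \<Longrightarrow> m i \<le> m j" and m_ge: "n \<le> m n" for i j n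
    by (auto simp: strict_mono_less_eq strict_mono_imp_increasing)
  have D_in: "D i \<subseteq> gball a (m j)" if "i < j" for i j
    using good[of i] gball_mono[OF m_mono[of "Suc i" j], of a] that by (auto simp: good_def)
  have D_out: "D i \<inter> gball a (Suc (m j)) = {}" if "j \<le> i" for i j
    using good[of i] gball_mono[of "Suc (m j)" "Suc (m i)" a] m_mono[OF that] by (auto simp: good_def)
  have DV: "D i \<subseteq> V" for i using D_in[of i "Suc i"] gball_subset by blast
  have finD: "finite (D i)" for i using D_in[of i "Suc i"] aV finite_subset finite_gball by blast
  define Z where "Z = V - (\<Union>n. D n)"
  define S where "S n = gball a (m (Suc n)) - gball a (m n) - D n" for n
  have SZ: "S n \<subseteq> Z" for n
  proof -
    have "S n \<inter> D i = {}" for i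
      using D_in[of i n] D_out[of "Suc n" i] gball_mono[of "m (Suc n)" "Suc (m (Suc n))" a]
      by (cases i n rule: linorder_cases) (auto simp: S_def)
    then show ?thesis using gball_subset[of a "m (Suc n)"] by (auto simp: Z_def S_def)
  qed
  \<comment> \<open>The boundary may reach one layer beyond \<open>gball a (m (Suc n))\<close>; this
    is why the next holes have to avoid the ball of radius \<open>Suc (m (Suc n))\<close>.\<close>
  have bdZ: "bdry (D n) \<subseteq> Z" for n
  proof
    fix p assume "p \<in> bdry (D n)"
    then obtain v where v: "v \<in> D n" "E v p" "p \<notin> D n" by (auto simp: bdry_def)
    have 1: "p \<notin> gball a (m n)"
      using gball_edge[OF aV E_sym[OF v(2)]] D_out[of n n] v(1) by auto
    have 2: "p \<in> gball a (Suc (m (Suc n)))"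
      using gball_edge[OF aV v(2)] D_in[of n "Suc n"] v(1) by auto
    have "p \<notin> D i" for i
      using D_in[of i n] D_out[of "Suc n" i] 1 2 v(3)
      by (cases i n rule: linorder_cases) auto
    then show "p \<in> Z" using E_in[OF v(2)] by (auto simp: Z_def)
  qed
  have "one_ended Z"
    unfolding one_ended_def
  proof (intro allI impI notI)
    fix P assume P: "P \<subseteq> Z" "infinite P" "infinite (Z - P)"
      and fin: "finite {(p, q). p \<in> P \<and> q \<in> Z - P \<and> E p q}"
    define Ed where "Ed = {(p, q). p \<in> P \<and> q \<in> Z - P \<and> E p q}"
    have "finite (fst ` Ed \<union> snd ` Ed)" "fst ` Ed \<union> snd ` Ed \<subseteq> V"
      using fin E_in by (auto simp: Ed_def)
    then obtain M0 where M0: "fst ` Ed \<union> snd ` Ed \<subseteq> gball a M0"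
      using finite_subset_gball by blast
    \<comment> \<open>All endpoints of cut edges are within radius \<open>M0\<close>, and
      \<open>S n\<close> lies outside it, so a path in \<open>S n\<close> cannot change
      sides.\<close>
    have same: "u \<in> P \<longleftrightarrow> v \<in> P" if "reach (S n) u v" "n \<ge> M0" for u v n
      using that(1) unfolding reach_def
    proof (induction rule: rtranclp_induct)
      case (step v w)
      have nb: "v \<notin> gball a M0" "w \<notin> gball a M0"
        using step(2) gball_mono[of M0 "m n" a] m_ge[of n] that(2) by (auto simp: S_def)
      have "v \<in> Z" "w \<in> Z" using step(2) SZ by auto
      moreover have "(v, w) \<notin> Ed" "(w, v) \<notin> Ed" using nb M0 by force+
      ultimately have "v \<in> P \<longleftrightarrow> w \<in> P"
        using step(2) E_sym unfolding Ed_def by blast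
      with step show ?case by blast
    qed simp
    \<comment> \<open>A cut of \<open>Z\<close> by finitely many edges extends to one of \<open>V\<close>: almost every hole has its whole
      boundary on one side.\<close>
    define P' where "P' = P \<union> (\<Union>n \<in> {n. bdry (D n) \<inter> P \<noteq> {}}. D n)"
    have "P' \<subseteq> V" using P(1) DV by (auto simp: P'_def Z_def)
    moreover have "infinite P'" using P(2) by (simp add: P'_def)
    moreover have "Z - P \<subseteq> V - P'" by (auto simp: P'_def Z_def)
    then have "infinite (V - P')" using P(3) finite_subset by blast
    ultimately have "infinite {(p, q). p \<in> P' \<and> q \<in> V - P' \<and> E p q}"
      using oe unfolding one_ended_def by blast
    \<comment> \<open>An edge from \<open>P\<close> into a hole stays in \<open>P'\<close>, since a
      hole adjacent to \<open>P\<close> is absorbed. An edge out of an absorbed hole with index at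
      least \<open>M0\<close> ends in its boundary, which lies entirely in \<open>P\<close>.\<close>
    moreover have "{(p, q). p \<in> P' \<and> q \<in> V - P' \<and> E p q} \<subseteq>
      Ed \<union> (\<Union>n < M0. \<Union>u \<in> D n. {u} \<times> {v. E u v})"
    proof clarify
      fix u v assume uv: "u \<in> P'" "v \<in> V" "v \<notin> P'" "E u v"
        "(u, v) \<notin> (\<Union>n < M0. \<Union>u \<in> D n. {u} \<times> {v. E u v})"
      show "(u, v) \<in> Ed"
      proof (cases "u \<in> P")
        case True
        have "v \<notin> D n" for n
        proof
          assume "v \<in> D n"
          then have "u \<in> bdry (D n) \<inter> P"
            using True P(1) uv(4) E_sym by (auto simp: bdry_def Z_def)
          with \<open>v \<in> D n\<close> uv(3) show False by (auto simp: P'_def)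
        qed
        then show ?thesis using True uv by (auto simp: Ed_def Z_def P'_def)
      next
        case False
        then obtain n p where n: "u \<in> D n" "p \<in> bdry (D n)" "p \<in> P"
          using uv(1) by (auto simp: P'_def)
        have "v \<notin> D n" using uv(3) n by (auto simp: P'_def)
        then have v: "v \<in> bdry (D n)" using n(1) uv(4) by (auto simp: bdry_def)
        have "\<not> n < M0" using uv(4,5) n(1) by blast
        then have "v \<in> P" using same[of n p v] good[of n] v n by (auto simp: good_def S_def)
        then show ?thesis using uv(3) by (auto simp: P'_def)
      qed
    qed
    moreover have "finite (Ed \<union> (\<Union>n < M0. \<Union>u \<in> D n. {u} \<times> {v. E u v}))"
      using fin finD E_fin by (auto simp: Ed_def)
    ultimately show False using finite_subset by blast
  qed
  moreover have "x n \<in> V \<and> n < gdist a (x n) \<and> gball (x n) n \<inter> Z = {}" for n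
  proof -
    have g: "x n \<in> V" "gball (x n) n \<subseteq> D n" using good[of n] by (auto simp: good_def)
    have "x n \<in> D n" using g by (auto simp: gball_def)
    then have "x n \<notin> gball a (Suc (m n))" using D_out[of n n] by blast
    then show ?thesis using g m_ge[of n] by (auto simp: gball_def Z_def)
  qed
  moreover have "y n \<in> V \<and> n < gdist a (y n) \<and> gball (y n) n \<subseteq> Z" for n
  proof -
    have g: "y n \<in> V" "gball (y n) n \<subseteq> S n" using good[of n] by (auto simp: good_def S_def)
    have "y n \<in> S n" using g by (auto simp: gball_def)
    then have "y n \<notin> gball a (m n)" by (auto simp: S_def)
    then show ?thesis using g SZ m_ge[of n] by (auto simp: gball_def)
  qed
  moreover have "Z \<subseteq> V" by (auto simp: Z_def)
  ultimately show ?thesis by blast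
qed

end

section \<open>The Higson corona of a proper metric space\<close>

text \<open>The topology is kept arbitrary because the fact is applied both to functions on
  \<open>X\<close> and to coordinates on the product.\<close>

lemma continuous_map_Lipschitz_comb:
  fixes \<phi> :: "real \<Rightarrow> real \<Rightarrow> real"
  assumes f: "continuous_map T euclideanreal f" and g: "continuous_map T euclideanreal g"
    and \<phi>: "\<And>a b a' b'. \<bar>\<phi> a b - \<phi> a' b'\<bar> \<le> L * (\<bar>a - a'\<bar> + \<bar>b - b'\<bar>)"
  shows "continuous_map T euclideanreal (\<lambda>x. \<phi> (f x) (g x))"
proof -
  have cont: "isCont (\<lambda>p. \<phi> (fst p) (snd p)) q" for q
    unfolding isCont_def
  proof (rule LIM_zero_cancel, rule Lim_null_comparison)
    show "\<forall>\<^sub>F p in at q. norm (\<phi> (fst p) (snd p) - \<phi> (fst q) (snd q)) \<le>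
        L * (\<bar>fst p - fst q\<bar> + \<bar>snd p - snd q\<bar>)"
      using \<phi> by simp
    have "((\<lambda>p. L * (\<bar>fst p - fst q\<bar> + \<bar>snd p - snd q\<bar>)) \<longlongrightarrow>
        L * (\<bar>fst q - fst q\<bar> + \<bar>snd q - snd q\<bar>)) (at q)"
      by (intro tendsto_intros)
    then show "((\<lambda>p. L * (\<bar>fst p - fst q\<bar> + \<bar>snd p - snd q\<bar>)) \<longlongrightarrow> 0) (at q)" by simp
  qed
  have "continuous_map euclidean euclideanreal (\<lambda>p. \<phi> (fst p) (snd p))"
    using cont by (simp add: continuous_at_imp_continuous_on)
  moreover have "continuous_map T euclidean (\<lambda>x. (f x, g x))"
    using continuous_map_pairedI[OF f g] by simp
  ultimately have "continuous_map T euclideanreal ((\<lambda>p. \<phi> (fst p) (snd p)) \<circ> (\<lambda>x. (f x, g x)))"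
    by (rule continuous_map_compose[rotated])
  then show ?thesis by (simp add: o_def)
qed

locale proper_unbounded =
  fixes X :: "'a metric" and a :: 'a
  assumes proper: "proper_metric X" and base: "a \<in> mspace X"
    and not_compact: "\<not> compact_space (mtopology_of X)"
begin

abbreviation M where "M \<equiv> mspace X"
abbreviation d where "d \<equiv> mdist X"
abbreviation H where "H \<equiv> higson_functions X"
abbreviation PT where "PT \<equiv> higson_product X"
abbreviation e where "e \<equiv> higson_eval X"

definition bdd :: "'a set \<Rightarrow> bool" where
  "bdd S \<longleftrightarrow> (\<exists>R. \<forall>s \<in> S. d a s \<le> R)"

definition cl :: "'a set \<Rightarrow> (('a \<Rightarrow> real) \<Rightarrow> real) set" where
  "cl S = PT closure_of (e ` S)"

definition corona :: "(('a \<Rightarrow> real) \<Rightarrow> real) set" where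
  "corona = cl M - e ` M"

definition corona_trace :: "'a set \<Rightarrow> (('a \<Rightarrow> real) \<Rightarrow> real) set" where
  "corona_trace S = cl S \<inter> corona"

section \<open>Bounded sets and slow oscillation\<close>

lemma bddI: "(\<And>s. s \<in> S \<Longrightarrow> d a s \<le> R) \<Longrightarrow> bdd S"
  by (auto simp: bdd_def)

lemma bdd_subset: "bdd T \<Longrightarrow> S \<subseteq> T \<Longrightarrow> bdd S"
  by (auto simp: bdd_def)

lemma bdd_Un [simp]: "bdd (S \<union> T) \<longleftrightarrow> bdd S \<and> bdd T"
proof
  assume "bdd S \<and> bdd T"
  then obtain R R' where "\<forall>s \<in> S. d a s \<le> R" "\<forall>s \<in> T. d a s \<le> R'" by (auto simp: bdd_def)
  then show "bdd (S \<union> T)" by (intro bddI[of _ "max R R'"]) (auto simp: le_max_iff_disj)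
qed (auto intro: bdd_subset)

lemma bounded_in_iff: "bounded_in X S \<longleftrightarrow> S \<subseteq> M \<and> bdd S"
proof -
  interpret Metric_space M d by simp
  show ?thesis
  proof
    assume "bounded_in X S"
    then obtain c B where B: "S \<subseteq> mcball c B" by (auto simp: bounded_in_def mbounded_def)
    then have "d a s \<le> d a c + B" if "s \<in> S" for s
      using mdist_triangle[of a X c s] base that by fastforce
    then show "S \<subseteq> M \<and> bdd S" using B bddI by auto
  next
    assume "S \<subseteq> M \<and> bdd S"
    then obtain R where "S \<subseteq> M" "\<forall>s \<in> S. d a s \<le> R" by (auto simp: bdd_def)
    then have "S \<subseteq> mcball a R" using base by auto
    then show "bounded_in X S" by (auto simp: bounded_in_def mbounded_def)
  qed
qed

lemma compactin_ball: "compactin (mtopology_of X) {x \<in> M. d a x \<le> R}"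
proof -
  have "{x \<in> M. d a x \<le> R} = mcball_of X a R" using base by auto
  then show ?thesis using proper base by (simp add: proper_metric_def)
qed

lemma not_bdd_space: "\<not> bdd M"
proof
  assume "bdd M"
  then obtain R where "\<forall>s \<in> M. d a s \<le> R" by (auto simp: bdd_def)
  then have "{x \<in> M. d a x \<le> R} = M" by auto
  then show False using compactin_ball[of R] not_compact by (simp add: compact_space_def)
qed

lemma compactin_bdd: "compactin (mtopology_of X) K \<Longrightarrow> K \<subseteq> M \<and> bdd K"
  using Metric_space.compactin_imp_mbounded[OF Metric_space_mspace_mdist]
  by (metis bounded_in_def bounded_in_iff mtopology_of_def)

lemma not_bddD: "\<not> bdd S \<Longrightarrow> \<exists>s \<in> S. R < d a s"
  by (meson bddI not_le)

lemma dist_self: "x \<in> M \<Longrightarrow> d x x = 0"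
  by simp

lemma tri: "x \<in> M \<Longrightarrow> y \<in> M \<Longrightarrow> d a y \<le> d a x + d x y"
  using mdist_triangle base by metis

text \<open>By properness, balls around \<open>a\<close> serve as the compact sets. Two points of a
  small ball are compared through its centre: with \<epsilon>/4 for each, the diameter is at most
  \<epsilon>/2 and thus strictly below \<epsilon>.\<close>

lemma higsonI:
  assumes cont: "continuous_map (mtopology_of X) euclideanreal f"
    and bd: "\<And>x. x \<in> M \<Longrightarrow> \<bar>f x\<bar> \<le> C"
    and osc: "\<And>r \<epsilon>. r > 0 \<Longrightarrow> \<epsilon> > 0 \<Longrightarrow>
      \<exists>R. \<forall>x \<in> M. \<forall>y \<in> M. R < d a x \<longrightarrow> d x y \<le> r \<longrightarrow> \<bar>f x - f y\<bar> < \<epsilon>"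
  shows "restrict f M \<in> H"
  unfolding higson_functions_def
proof (intro CollectI conjI allI impI)
  show "restrict f M \<in> extensional M" by simp
  show "continuous_map (mtopology_of X) euclideanreal (restrict f M)"
    using continuous_map_eq[OF cont] by simp
  show "bounded (restrict f M ` M)"
    unfolding bounded_iff using bd by (intro exI[of _ C]) auto
  fix r \<epsilon> :: real assume r: "0 < r" "0 < \<epsilon>"
  then obtain R where R: "\<forall>x \<in> M. \<forall>y \<in> M. R < d a x \<longrightarrow> d x y \<le> r \<longrightarrow> \<bar>f x - f y\<bar> < \<epsilon> / 4"
    using osc[of r "\<epsilon> / 4"] by auto
  have "diameter (restrict f M ` mcball_of X x r) < \<epsilon>" if "x \<in> M - {x \<in> M. d a x \<le> R}" for x
  proof -
    have x: "x \<in> M" "R < d a x" using that by auto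
    have "diameter (restrict f M ` mcball_of X x r) \<le> \<epsilon> / 2"
    proof (rule diameter_le)
      fix u v assume "u \<in> restrict f M ` mcball_of X x r" "v \<in> restrict f M ` mcball_of X x r"
      then obtain y z where yz: "y \<in> M" "z \<in> M" "d x y \<le> r" "d x z \<le> r" "u = f y" "v = f z" by auto
      have "\<bar>f x - f y\<bar> < \<epsilon> / 4" "\<bar>f x - f z\<bar> < \<epsilon> / 4" using R x yz by auto
      then have "\<bar>f y - f z\<bar> \<le> \<epsilon> / 2" by linarith
      then show "norm (u - v) \<le> \<epsilon> / 2" using yz by simp
    qed (use r in auto)
    then show ?thesis using r by simp
  qed
  then show "\<exists>K. compactin (mtopology_of X) K \<and>
      (\<forall>x\<in>M - K. diameter (restrict f M ` mcball_of X x r) < \<epsilon>)"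
    using compactin_ball by blast
qed

lemma higson_cont: "f \<in> H \<Longrightarrow> continuous_map (mtopology_of X) euclideanreal f"
  and higson_bounded: "f \<in> H \<Longrightarrow> bounded (f ` M)"
  by (auto simp: higson_functions_def)

lemma higson_osc:
  assumes f: "f \<in> H" and "\<epsilon> > 0"
  shows "\<exists>R. \<forall>x \<in> M. \<forall>y \<in> M. R < d a x \<longrightarrow> d x y \<le> r \<longrightarrow> \<bar>f x - f y\<bar> < \<epsilon>"
proof -
  \<comment> \<open>The definition of a Higson function speaks of positive radii only, while
    \<open>r\<close> is arbitrary here.\<close>
  define r' where "r' = max r 1"
  have "r' > 0" by (simp add: r'_def)
  then obtain K where K: "compactin (mtopology_of X) K"
    "\<forall>x \<in> M - K. diameter (f ` mcball_of X x r') < \<epsilon>"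
    using assms unfolding higson_functions_def by blast
  obtain R where R: "\<forall>x \<in> K. d a x \<le> R" using compactin_bdd[OF K(1)] by (auto simp: bdd_def)
  have "\<bar>f x - f y\<bar> < \<epsilon>" if "x \<in> M" "y \<in> M" "R < d a x" "d x y \<le> r" for x y
  proof -
    have "x \<in> M - K" using that R by force
    then have "diameter (f ` mcball_of X x r') < \<epsilon>" using K(2) by blast
    moreover have "x \<in> mcball_of X x r'" "y \<in> mcball_of X x r'"
      using that by (auto simp: r'_def dist_self)
    moreover have "bounded (f ` mcball_of X x r')"
      using higson_bounded[OF f] by (rule bounded_subset) auto
    ultimately show ?thesis
      using diameter_bounded_bound[of "f ` mcball_of X x r'" "f x" "f y"]
      by (force simp: dist_real_def)
  qed
  then show ?thesis by blast
qed

section \<open>Closures in the product of intervals\<close>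

lemma Hausdorff_PT: "Hausdorff_space PT"
  unfolding higson_product_def Hausdorff_space_product_topology
  by (simp add: Hausdorff_space_subtopology)

lemma compact_PT: "compact_space PT"
  unfolding higson_product_def compact_space_product_topology
  by (simp add: compact_space_subtopology)

lemma e_apply: "f \<in> H \<Longrightarrow> e x f = f x"
  by (simp add: higson_eval_def)

lemma proj_cont: "f \<in> H \<Longrightarrow> continuous_map PT euclideanreal (\<lambda>p. p f)"
  unfolding higson_product_def
  by (rule continuous_map_into_fulltopology, rule continuous_map_product_projection)

lemma e_cont: "continuous_map (mtopology_of X) PT e"
  unfolding higson_product_def continuous_map_componentwise
proof (intro conjI ballI)
  show "e ` topspace (mtopology_of X) \<subseteq> extensional H"
    by (auto simp: higson_eval_def)
  fix f assume f: "f \<in> H"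
  have "continuous_map (mtopology_of X) (top_of_set {Inf (f ` M)..Sup (f ` M)}) f"
    using higson_cont[OF f] higson_bounded[OF f]
    by (auto simp: continuous_map_in_subtopology bounded_imp_bdd_above bounded_imp_bdd_below
        intro!: cINF_lower cSUP_upper)
  then show "continuous_map (mtopology_of X) (top_of_set {Inf (f ` M)..Sup (f ` M)}) (\<lambda>x. e x f)"
    using f by (simp add: e_apply)
qed

lemma e_image: "S \<subseteq> M \<Longrightarrow> e ` S \<subseteq> topspace PT"
  using continuous_map_image_subset_topspace[OF e_cont] by auto

lemma cl_subset: "cl S \<subseteq> topspace PT"
  by (simp add: cl_def closure_of_subset_topspace)

lemma cl_mono: "S \<subseteq> T \<Longrightarrow> cl S \<subseteq> cl T"
  unfolding cl_def by (intro closure_of_mono image_mono)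

lemma cl_Un: "cl (S \<union> T) = cl S \<union> cl T"
  by (simp add: cl_def image_Un closure_of_Un)

lemma closedin_cl: "closedin PT (cl S)"
  by (simp add: cl_def)

lemma e_in_cl: "S \<subseteq> M \<Longrightarrow> x \<in> S \<Longrightarrow> e x \<in> cl S"
  unfolding cl_def using closure_of_subset[OF e_image] by blast

lemma cl_closed:
  assumes f: "continuous_map PT euclideanreal f" and C: "closed C"
    and S: "S \<subseteq> M" "\<And>s. s \<in> S \<Longrightarrow> f (e s) \<in> C" and p: "p \<in> cl S"
  shows "f p \<in> C"
proof -
  have "closedin PT {q \<in> topspace PT. f q \<in> C}"
    using closedin_continuous_map_preimage[OF f] C by simp
  moreover have "e ` S \<subseteq> {q \<in> topspace PT. f q \<in> C}" using S e_image[OF S(1)] by auto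
  ultimately have "cl S \<subseteq> {q \<in> topspace PT. f q \<in> C}"
    unfolding cl_def by (simp add: closure_of_minimal)
  then show ?thesis using p by blast
qed

lemma cl_le: "f \<in> H \<Longrightarrow> S \<subseteq> M \<Longrightarrow> (\<And>s. s \<in> S \<Longrightarrow> f s \<le> c) \<Longrightarrow> p \<in> cl S \<Longrightarrow> p f \<le> c"
  using cl_closed[OF proj_cont, of f "{..c}" S p] by (simp add: e_apply)

lemma cl_ge: "f \<in> H \<Longrightarrow> S \<subseteq> M \<Longrightarrow> (\<And>s. s \<in> S \<Longrightarrow> c \<le> f s) \<Longrightarrow> p \<in> cl S \<Longrightarrow> c \<le> p f"
  using cl_closed[OF proj_cont, of f "{c..}" S p] by (simp add: e_apply)

lemma cl_open:
  assumes f: "f \<in> H" and U: "open U" and S: "S \<subseteq> M" and p: "p \<in> cl S" "p f \<in> U"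
  shows "p \<in> cl {s \<in> S. f s \<in> U}"
proof -
  define W where "W = {q \<in> topspace PT. q f \<in> U}"
  have "openin PT W"
    using openin_continuous_map_preimage[OF proj_cont[OF f]] U by (simp add: W_def)
  then have "W \<inter> PT closure_of (e ` S) \<subseteq> PT closure_of (W \<inter> e ` S)"
    by (rule openin_Int_closure_of_subset)
  moreover have "p \<in> W" using p cl_subset by (auto simp: W_def)
  moreover have "W \<inter> e ` S = e ` {s \<in> S. f s \<in> U}"
    using f e_image[OF S] by (auto simp: W_def e_apply)
  ultimately show ?thesis using p by (auto simp: cl_def)
qed

section \<open>Operations on Higson functions and cut-off functions\<close>

text \<open>A Lipschitz \<phi> preserves boundedness and slow oscillation. The formula for
  \<open>p k\<close> is clear at the points \<open>e x\<close> and passes to their closure by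
  continuity, so combinations can be evaluated at points of the corona.\<close>

lemma Lipschitz_comb:
  fixes \<phi> :: "real \<Rightarrow> real \<Rightarrow> real"
  assumes f: "f \<in> H" and g: "g \<in> H"
    and \<phi>: "\<And>a b a' b'. \<bar>\<phi> a b - \<phi> a' b'\<bar> \<le> L * (\<bar>a - a'\<bar> + \<bar>b - b'\<bar>)"
  shows "\<exists>k \<in> H. \<forall>p \<in> cl M. p k = \<phi> (p f) (p g)"
proof -
  define k where "k = (\<lambda>x \<in> M. \<phi> (f x) (g x))"
  have L: "0 \<le> L"
    using \<phi>[of 1 0 0 0] by (smt (verit) mult_cancel_left1)
  obtain F G where FG: "\<forall>x \<in> M. \<bar>f x\<bar> \<le> F" "\<forall>x \<in> M. \<bar>g x\<bar> \<le> G"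
    using higson_bounded[OF f] higson_bounded[OF g] by (auto simp: bounded_iff)
  have kH: "k \<in> H" unfolding k_def
  proof (rule higsonI)
    show "continuous_map (mtopology_of X) euclideanreal (\<lambda>x. \<phi> (f x) (g x))"
      using continuous_map_Lipschitz_comb[OF higson_cont[OF f] higson_cont[OF g] \<phi>] .
    show "\<bar>\<phi> (f x) (g x)\<bar> \<le> \<bar>\<phi> 0 0\<bar> + L * (F + G)" if "x \<in> M" for x
    proof -
      have "\<bar>\<phi> (f x) (g x) - \<phi> 0 0\<bar> \<le> L * (\<bar>f x\<bar> + \<bar>g x\<bar>)" using \<phi>[of "f x" "g x" 0 0] by simp
      also have "\<dots> \<le> L * (F + G)" using FG that L by (intro mult_left_mono add_mono) auto
      finally show ?thesis by linarith
    qed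
    fix r \<epsilon> :: real assume "0 < r" "0 < \<epsilon>"
    \<comment> \<open>Using \<open>L + 1\<close> instead of \<open>L\<close> avoids a division by 0
      and makes the final estimate strict.\<close>
    define \<delta> where "\<delta> = \<epsilon> / (2 * (L + 1))"
    have \<delta>: "\<delta> > 0" using \<open>0 < \<epsilon>\<close> L by (simp add: \<delta>_def)
    obtain R1 where R1: "\<forall>x \<in> M. \<forall>y \<in> M. R1 < d a x \<longrightarrow> d x y \<le> r \<longrightarrow> \<bar>f x - f y\<bar> < \<delta>"
      using higson_osc[OF f \<delta>] by blast
    obtain R2 where R2: "\<forall>x \<in> M. \<forall>y \<in> M. R2 < d a x \<longrightarrow> d x y \<le> r \<longrightarrow> \<bar>g x - g y\<bar> < \<delta>"
      using higson_osc[OF g \<delta>] by blast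
    have "\<bar>\<phi> (f x) (g x) - \<phi> (f y) (g y)\<bar> < \<epsilon>"
      if "x \<in> M" "y \<in> M" "max R1 R2 < d a x" "d x y \<le> r" for x y
    proof -
      have "\<bar>\<phi> (f x) (g x) - \<phi> (f y) (g y)\<bar> \<le> L * (\<bar>f x - f y\<bar> + \<bar>g x - g y\<bar>)" by (rule \<phi>)
      also have "\<dots> \<le> L * (\<delta> + \<delta>)"
        using R1 R2 that L by (intro mult_left_mono add_mono) (auto intro: less_imp_le)
      also have "\<dots> < (L + 1) * (\<delta> + \<delta>)" using \<delta> by (simp add: algebra_simps)
      also have "\<dots> = \<epsilon>"
      proof -
        have "2 * (L + 1) * \<delta> = \<epsilon>" using L by (simp add: \<delta>_def)
        then show ?thesis by (simp add: algebra_simps)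
      qed
      finally show ?thesis .
    qed
    then show "\<exists>R. \<forall>x \<in> M. \<forall>y \<in> M. R < d a x \<longrightarrow> d x y \<le> r \<longrightarrow>
        \<bar>\<phi> (f x) (g x) - \<phi> (f y) (g y)\<bar> < \<epsilon>" by blast
  qed
  have "p k - \<phi> (p f) (p g) \<in> {0}" if "p \<in> cl M" for p
  proof (rule cl_closed[of "\<lambda>p. p k - \<phi> (p f) (p g)"])
    show "continuous_map PT euclideanreal (\<lambda>p. p k - \<phi> (p f) (p g))"
      by (intro continuous_map_diff proj_cont kH
          continuous_map_Lipschitz_comb[OF proj_cont[OF f] proj_cont[OF g] \<phi>])
    show "\<And>s. s \<in> M \<Longrightarrow> e s k - \<phi> (e s f) (e s g) \<in> {0}"
      using f g kH by (auto simp: e_apply k_def)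
  qed (use that in auto)
  then show ?thesis using kH by (intro bexI[of _ k]) auto
qed

lemma higson_affine:
  assumes "f \<in> H" shows "\<exists>k \<in> H. \<forall>p \<in> cl M. p k = c * p f + b"
proof -
  have "\<bar>(c * x + b) - (c * x' + b)\<bar> \<le> \<bar>c\<bar> * (\<bar>x - x'\<bar> + \<bar>y - y'\<bar>)" for x y x' y' :: real
  proof -
    have "\<bar>(c * x + b) - (c * x' + b)\<bar> = \<bar>c\<bar> * \<bar>x - x'\<bar>"
      by (simp add: abs_mult[symmetric] right_diff_distrib)
    also have "\<dots> \<le> \<bar>c\<bar> * (\<bar>x - x'\<bar> + \<bar>y - y'\<bar>)" by (intro mult_left_mono) auto
    finally show ?thesis .
  qed
  from Lipschitz_comb[OF assms assms, of "\<lambda>x _. c * x + b", OF this] show ?thesis by simp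
qed

lemma higson_max:
  assumes "f \<in> H" "g \<in> H" shows "\<exists>k \<in> H. \<forall>p \<in> cl M. p k = max (p f) (p g)"
proof -
  have "\<bar>max x y - max x' y'\<bar> \<le> 1 * (\<bar>x - x'\<bar> + \<bar>y - y'\<bar>)" for x y x' y' :: real by auto
  from Lipschitz_comb[OF assms, of max, OF this] show ?thesis .
qed

lemma higson_const: "(\<lambda>x \<in> M. c) \<in> H"
  by (rule higsonI[of _ "\<bar>c\<bar>"]) auto

text \<open>Beyond radius \<open>R + 1 + r\<close> the function vanishes on whole balls of radius
  \<open>r\<close>, so slow oscillation is immediate. It serves to keep \<open>e x\<close> out of
  the closure of the points far from \<open>a\<close>.\<close>

lemma exists_bump:
  "\<exists>f \<in> H. \<forall>x \<in> M. 0 \<le> f x \<and> (d a x \<le> R \<longrightarrow> f x = 1) \<and> (R + 1 < d a x \<longrightarrow> f x = 0)"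
proof -
  define f where "f x = max 0 (min 1 (R + 1 - d a x))" for x
  have "restrict f M \<in> H"
  proof (rule higsonI)
    show "continuous_map (mtopology_of X) euclideanreal f"
      unfolding f_def[abs_def] using continuous_on_mdist[OF base]
      by (intro continuous_intros) (use base in auto)
    show "\<bar>f x\<bar> \<le> 1" for x by (auto simp: f_def)
    fix r \<epsilon> :: real assume "0 < r" "0 < \<epsilon>"
    have "\<bar>f x - f y\<bar> < \<epsilon>" if "x \<in> M" "y \<in> M" "R + 1 + r < d a x" "d x y \<le> r" for x y
      using tri[of y x] that \<open>0 < r\<close> \<open>0 < \<epsilon>\<close> by (simp add: f_def mdist_commute[of X y x])
    then show "\<exists>R. \<forall>x\<in>M. \<forall>y\<in>M. R < d a x \<longrightarrow> d x y \<le> r \<longrightarrow> \<bar>f x - f y\<bar> < \<epsilon>" by blast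
  qed
  then show ?thesis by (intro bexI[of _ "restrict f M"]) (auto simp: f_def)
qed

section \<open>The corona and the traces of subsets\<close>

lemma cl_bdd:
  assumes "S \<subseteq> M" "bdd S" shows "cl S \<subseteq> e ` M"
proof -
  obtain R where R: "S \<subseteq> {x \<in> M. d a x \<le> R}" using assms by (auto simp: bdd_def)
  have "compactin PT (e ` {x \<in> M. d a x \<le> R})"
    using image_compactin[OF compactin_ball e_cont] .
  then have "closedin PT (e ` {x \<in> M. d a x \<le> R})"
    using Hausdorff_PT compactin_imp_closedin by blast
  moreover have "e ` S \<subseteq> e ` {x \<in> M. d a x \<le> R}" using R by blast
  ultimately have "cl S \<subseteq> e ` {x \<in> M. d a x \<le> R}" unfolding cl_def by (rule closure_of_minimal[rotated])
  then show ?thesis by blast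
qed

lemma corona_not_bdd:
  assumes "p \<in> corona" "p \<in> cl S" "S \<subseteq> M" shows "\<not> bdd S"
  using cl_bdd assms by (auto simp: corona_def)

text \<open>The corona becomes an intersection of closures of complements of balls. This makes it
  closed, and it lets a compactness argument produce points of it.\<close>

lemma corona_iff:
  assumes p: "p \<in> cl M"
  shows "p \<in> corona \<longleftrightarrow> (\<forall>R. p \<in> cl {x \<in> M. R < d a x})"
proof
  assume c: "p \<in> corona"
  show "\<forall>R. p \<in> cl {x \<in> M. R < d a x}"
  proof
    fix R
    have "M = {x \<in> M. R < d a x} \<union> {x \<in> M. d a x \<le> R}" by auto
    then have "p \<in> cl {x \<in> M. R < d a x} \<union> cl {x \<in> M. d a x \<le> R}" using p cl_Un by metis
    moreover have "p \<notin> cl {x \<in> M. d a x \<le> R}"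
      using corona_not_bdd[OF c, of "{x \<in> M. d a x \<le> R}"] by (auto simp: bdd_def)
    ultimately show "p \<in> cl {x \<in> M. R < d a x}" by blast
  qed
next
  assume far: "\<forall>R. p \<in> cl {x \<in> M. R < d a x}"
  have "p \<noteq> e x" if x: "x \<in> M" for x
  proof
    assume px: "p = e x"
    obtain f where f: "f \<in> H" "\<forall>y \<in> M. 0 \<le> f y \<and> (d a y \<le> d a x \<longrightarrow> f y = 1) \<and> (d a x + 1 < d a y \<longrightarrow> f y = 0)"
      using exists_bump[of "d a x"] by blast
    have "p f \<le> 0" by (rule cl_le[OF f(1) _ _ far[rule_format, of "d a x + 1"]]) (use f in auto)
    moreover have "p f = 1" using f x by (simp add: px e_apply)
    ultimately show False by simp
  qed
  then show "p \<in> corona" using p by (auto simp: corona_def)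
qed

lemma closedin_corona: "closedin PT corona"
proof -
  have "corona = cl M \<inter> (\<Inter>R. cl {x \<in> M. R < d a x})"
    using corona_iff by (auto simp: corona_def)
  moreover have "closedin PT (\<Inter>R. cl {x \<in> M. R < d a x})"
    by (rule closedin_Inter) (auto simp: closedin_cl)
  ultimately show ?thesis using closedin_cl by auto
qed

lemma corona_subset: "corona \<subseteq> cl M"
  by (auto simp: corona_def)

lemma closedin_trace: "closedin PT (corona_trace S)"
  unfolding corona_trace_def using closedin_cl closedin_corona by blast

lemma trace_M: "corona_trace M = corona"
  using corona_subset by (auto simp: corona_trace_def)

lemma trace_Un: "corona_trace (S \<union> T) = corona_trace S \<union> corona_trace T"
  by (auto simp: corona_trace_def cl_Un)

lemma trace_subset: "corona_trace S \<subseteq> corona"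
  by (auto simp: corona_trace_def)

lemma trace_mono: "S \<subseteq> T \<Longrightarrow> corona_trace S \<subseteq> corona_trace T"
  using cl_mono by (auto simp: corona_trace_def)

lemma trace_bdd: "S \<subseteq> M \<Longrightarrow> bdd S \<Longrightarrow> corona_trace S = {}"
  using corona_not_bdd by (auto simp: corona_trace_def)

text \<open>The closures of the parts of \<open>S\<close> outside the balls of radius
  \<open>n\<close> are nested, closed and nonempty, and a common point of them belongs to the
  corona.\<close>

lemma trace_nonempty:
  assumes S: "S \<subseteq> M" "\<not> bdd S" shows "corona_trace S \<noteq> {}"
proof -
  define C where "C n = cl {x \<in> S. real n < d a x}" for n :: nat
  have "(\<Inter>n. C n) \<noteq> {}"
  proof (rule compact_space_imp_nest[OF compact_PT])
    show "\<And>n. closedin PT (C n)" by (simp add: C_def closedin_cl)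
    show "C n \<noteq> {}" for n
    proof -
      obtain x where "x \<in> {x \<in> S. real n < d a x}" using not_bddD[OF S(2)] by blast
      then have "e x \<in> C n" unfolding C_def using S(1) by (intro e_in_cl) auto
      then show ?thesis by blast
    qed
    show "decseq C" unfolding decseq_def C_def by (auto intro!: cl_mono)
  qed
  then obtain p where p: "\<And>n. p \<in> C n" by blast
  have "p \<in> cl S" using p[of 0] cl_mono[of "{x \<in> S. real 0 < d a x}" S] by (auto simp: C_def)
  moreover have "p \<in> cl {x \<in> M. R < d a x}" for R
  proof -
    obtain n :: nat where "R < real n" using reals_Archimedean2 by blast
    then have "{x \<in> S. real n < d a x} \<subseteq> {x \<in> M. R < d a x}" using S by auto
    then show ?thesis using p[of n] cl_mono by (auto simp: C_def)
  qed
  moreover have "p \<in> cl M" using \<open>p \<in> cl S\<close> cl_mono[OF S(1)] by blast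
  ultimately show ?thesis using corona_iff by (auto simp: corona_trace_def)
qed

text \<open>Together with \<open>trace_not_bdd\<close> this converts a strict inequality at a point
  of the trace into an unbounded set of points of \<open>S\<close> that satisfy it.\<close>

lemma trace_open:
  assumes "f \<in> H" "open U" "S \<subseteq> M" "p \<in> corona_trace S" "p f \<in> U"
  shows "p \<in> corona_trace {s \<in> S. f s \<in> U}"
  using cl_open[OF assms(1-3), of p] assms(4,5) by (auto simp: corona_trace_def)

lemma trace_not_bdd: "S \<subseteq> M \<Longrightarrow> p \<in> corona_trace S \<Longrightarrow> \<not> bdd S"
  using corona_not_bdd by (auto simp: corona_trace_def)

lemma higson_corona_eq: "higson_corona X = subtopology PT corona"
proof -
  have "topspace (higson_compactification X) = cl M"
    using cl_subset by (auto simp: higson_compactification_def cl_def)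
  then show ?thesis
    unfolding higson_corona_def corona_def
    by (simp add: higson_compactification_def cl_def subtopology_subtopology Int_absorb1 Diff_subset)
qed

lemma topspace_corona: "topspace (higson_corona X) = corona"
  unfolding higson_corona_eq using corona_subset cl_subset by auto

text \<open>Urysohn's lemma for the Higson functions: these form a lattice, and compactness is applied
  first to one closed set and then to the other.\<close>

lemma separate_from_compact:
  assumes C: "compactin PT C" "C \<subseteq> cl M"
    and ex: "\<And>q. q \<in> C \<Longrightarrow> \<exists>g \<in> H. (\<forall>p \<in> A. p g < 0) \<and> q g > 1" and A: "A \<subseteq> cl M"
  shows "\<exists>g \<in> H. (\<forall>p \<in> A. p g < 0) \<and> (\<forall>q \<in> C. q g > 1)"
proof -
  define G where "G = {g \<in> H. \<forall>p \<in> A. p g < 0}"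
  define W where "W g = {q \<in> topspace PT. q g \<in> {1<..}}" for g
  have "openin PT U" if U: "U \<in> W ` G" for U
  proof -
    obtain g where g: "g \<in> H" "U = W g" using U by (auto simp: G_def)
    then show ?thesis
      unfolding g(2) W_def by (intro openin_continuous_map_preimage[OF proj_cont]) auto
  qed
  moreover have "C \<subseteq> \<Union> (W ` G)"
    using ex cl_subset C(2) by (fastforce simp: G_def W_def)
  ultimately obtain \<F> where F: "finite \<F>" "\<F> \<subseteq> W ` G" "C \<subseteq> \<Union> \<F>"
    using compactinD[OF C(1), of "W ` G"] by blast
  then obtain G0 where G0: "finite G0" "G0 \<subseteq> G" "C \<subseteq> \<Union> (W ` G0)"
    by (metis finite_subset_image)
  have "\<exists>f \<in> G. \<forall>q \<in> cl M. (\<exists>g \<in> G0. q g > 1) \<longrightarrow> q f > 1"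
    using G0(1,2)
  proof (induction G0)
    case empty
    have "p (\<lambda>x \<in> M. -1) \<le> -1" if "p \<in> cl M" for p
      by (rule cl_le[OF higson_const _ _ that]) auto
    then have "(\<lambda>x \<in> M. -1) \<in> G" using higson_const A by (fastforce simp: G_def)
    then show ?case by blast
  next
    case (insert h G0)
    then obtain f where f: "f \<in> G" "\<forall>q \<in> cl M. (\<exists>g \<in> G0. q g > 1) \<longrightarrow> q f > 1" by blast
    obtain k where k: "k \<in> H" "\<forall>p \<in> cl M. p k = max (p f) (p h)"
      using higson_max[of f h] f insert.prems by (auto simp: G_def)
    have "p k < 0" if "p \<in> A" for p
    proof -
      have "p f < 0" "p h < 0" "p k = max (p f) (p h)"
        using that k(2) f(1) insert.prems A by (auto simp: G_def)
      then show ?thesis by simp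
    qed
    then have "k \<in> G" using k(1) by (simp add: G_def)
    moreover have "p f \<le> p k \<and> p h \<le> p k" if "p \<in> cl M" for p
    proof -
      have "p k = max (p f) (p h)" using k(2) that by blast
      then show ?thesis by simp
    qed
    ultimately show ?case using f(2) by (intro bexI[of _ k]) fastforce+
  qed
  then obtain f where f: "f \<in> G" "\<forall>q \<in> cl M. (\<exists>g \<in> G0. q g > 1) \<longrightarrow> q f > 1" by blast
  have "q f > 1" if "q \<in> C" for q
    using f(2) G0(3) that C(2) by (fastforce simp: W_def)
  then show ?thesis using f(1) by (auto simp: G_def)
qed

lemma separate_points:
  assumes "p \<in> cl M" "q \<in> cl M" "p \<noteq> q"
  shows "\<exists>g \<in> H. p g < 0 \<and> q g > 1"
proof -
  have "p \<in> extensional H" "q \<in> extensional H"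
    using assms cl_subset by (auto simp: higson_product_def PiE_def)
  then obtain f where f: "f \<in> H" "p f \<noteq> q f" using assms(3) extensionalityI by metis
  \<comment> \<open>The affine map below sends \<open>p f\<close> to -1 and \<open>q f\<close> to
    2.\<close>
  define c where "c = 3 / (q f - p f)"
  obtain k where k: "k \<in> H" "\<forall>r \<in> cl M. r k = c * r f + (- 1 - c * p f)"
    using higson_affine[OF f(1)] by blast
  have "q k = c * (q f - p f) - 1" using k assms by (simp add: algebra_simps)
  moreover have "c * (q f - p f) = 3"
    using f(2) c_def by (metis eq_iff_diff_eq_0 nonzero_eq_divide_eq)
  ultimately have "q k = 2" by simp
  moreover have "p k = c * p f + (- 1 - c * p f)" using k(2) assms(1) by blast
  then have "p k = -1" by simp
  ultimately show ?thesis using k(1) by (intro bexI[of _ k]) auto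
qed

lemma separate_compact:
  assumes C: "compactin PT C" "C \<subseteq> cl M" and D: "compactin PT D" "D \<subseteq> cl M" and disj: "C \<inter> D = {}"
  shows "\<exists>f \<in> H. (\<forall>p \<in> C. p f < 0) \<and> (\<forall>q \<in> D. q f > 1)"
proof (rule separate_from_compact[OF D(1) _ _ C(2)])
  fix q assume q: "q \<in> D"
  have "\<exists>g \<in> H. (\<forall>p \<in> {q}. p g < 0) \<and> (\<forall>p \<in> C. p g > 1)"
  proof (rule separate_from_compact[OF C])
    fix p assume "p \<in> C"
    then show "\<exists>g\<in>H. (\<forall>p\<in>{q}. p g < 0) \<and> 1 < p g"
      using separate_points[of q p] q C D disj by auto
  qed (use q D in auto)
  then obtain g where g: "g \<in> H" "q g < 0" "\<forall>p \<in> C. p g > 1" by auto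
  \<comment> \<open>The reflection of t to 1 - t exchanges the conditions "negative" and "larger
    than 1".\<close>
  obtain k where k: "k \<in> H" "\<forall>p \<in> cl M. p k = - 1 * p g + 1"
    using higson_affine[OF g(1)] by blast
  show "\<exists>g\<in>H. (\<forall>p\<in>C. p g < 0) \<and> 1 < q g"
  proof (intro bexI conjI ballI)
    show "p k < 0" if "p \<in> C" for p
    proof -
      have "p k = - 1 * p g + 1" "1 < p g" using k(2) g(3) C(2) that by blast+
      then show ?thesis by simp
    qed
    have "q k = - 1 * q g + 1" using k(2) q D(2) by blast
    then show "1 < q k" using g(2) by simp
  qed (rule k(1))
qed (rule D(2))

lemma separate_closed:
  assumes "closedin PT C" "closedin PT D" "C \<subseteq> cl M" "D \<subseteq> cl M" "C \<inter> D = {}"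
  shows "\<exists>f \<in> H. (\<forall>p \<in> C. p f < 0) \<and> (\<forall>q \<in> D. q f > 1)"
  using separate_compact closedin_compact_space[OF compact_PT] assms by blast

section \<open>Coarse disjointness and separation\<close>

text \<open>The two sets diverge from each other at infinity. Bounding \<open>x\<close> alone is
  enough, as \<open>y\<close> is within distance \<open>r\<close> of it.\<close>

definition coarsely_disjoint :: "'a set \<Rightarrow> 'a set \<Rightarrow> bool" where
  "coarsely_disjoint P Q \<longleftrightarrow> (\<forall>r. \<exists>R. \<forall>x \<in> P. \<forall>y \<in> Q. d x y \<le> r \<longrightarrow> d a x \<le> R)"

definition sdist :: "'a set \<Rightarrow> 'a \<Rightarrow> real" where
  "sdist S x = (INF s \<in> S. d x s)"

lemma sdist_bdd_below: "bdd_below (d x ` S)"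
  by (intro bdd_belowI[of _ 0]) auto

lemma sdist_nonneg: "S \<noteq> {} \<Longrightarrow> 0 \<le> sdist S x"
  unfolding sdist_def by (rule cINF_greatest) auto

lemma sdist_le: "s \<in> S \<Longrightarrow> sdist S x \<le> d x s"
  unfolding sdist_def by (rule cINF_lower[OF sdist_bdd_below])

lemma sdist_in: "s \<in> S \<Longrightarrow> s \<in> M \<Longrightarrow> sdist S s = 0"
  using sdist_le[of s S s] sdist_nonneg[of S s] dist_self[of s] by fastforce

lemma sdist_less: "S \<noteq> {} \<Longrightarrow> sdist S x < t \<Longrightarrow> \<exists>s \<in> S. d x s < t"
  unfolding sdist_def using cINF_less_iff[OF _ sdist_bdd_below] by blast

lemma sdist_Lipschitz:
  assumes "S \<subseteq> M" "S \<noteq> {}" "x \<in> M" "y \<in> M"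
  shows "\<bar>sdist S x - sdist S y\<bar> \<le> d x y"
proof -
  have *: "sdist S x \<le> d x y + sdist S y" if "x \<in> M" "y \<in> M" for x y
  proof -
    have "sdist S x - d x y \<le> d y s" if "s \<in> S" for s
      using sdist_le[OF that, of x] mdist_triangle[of x X y s] \<open>x \<in> M\<close> \<open>y \<in> M\<close> that assms(1) by force
    then have "sdist S x - d x y \<le> sdist S y"
      unfolding sdist_def[of S y] using assms(2) by (intro cINF_greatest) auto
    then show ?thesis by simp
  qed
  show ?thesis using *[of x y] *[of y x] assms mdist_commute[of X x y] by auto
qed

lemma sdist_cont:
  assumes "S \<subseteq> M" "S \<noteq> {}"
  shows "continuous_map (mtopology_of X) euclideanreal (sdist S)"
proof -
  have "Lipschitz_continuous_map X euclidean_metric (sdist S)"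
    unfolding Lipschitz_continuous_map_def using sdist_Lipschitz[OF assms]
    by (auto simp: dist_real_def intro!: exI[of _ 1])
  then show ?thesis using Lipschitz_continuous_imp_continuous_map by fastforce
qed

text \<open>The function is the usual quotient of the distance to \<open>P\<close> by the sum of the
  distances to \<open>P\<close> and \<open>Q\<close>. Coarse disjointness drives the denominator to
  infinity, so this quotient of Lipschitz functions oscillates slowly.\<close>

lemma coarsely_disjoint_separate:
  assumes P: "P \<subseteq> M" "P \<noteq> {}" and Q: "Q \<subseteq> M" "Q \<noteq> {}" and disj: "coarsely_disjoint P Q"
  shows "\<exists>f \<in> H. (\<forall>x \<in> P. f x = 0) \<and> bdd {x \<in> Q. f x \<noteq> 1}"
proof -
  \<comment> \<open>The lower bound 1 avoids dividing by 0 where the closures of \<open>P\<close> and \<open>Q\<close> meet.\<close>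
  define s where "s x = max 1 (sdist P x + sdist Q x)" for x
  define f where "f x = sdist P x / s x" for x
  have s1: "1 \<le> s x" for x by (simp add: s_def)
  have s_far: "\<exists>R. \<forall>x \<in> M. R < d a x \<longrightarrow> t < s x" for t
  proof -
    \<comment> \<open>Where \<open>s x \<le> t\<close>, some points of \<open>P\<close> and of
      \<open>Q\<close> are within \<open>t + 1\<close> of \<open>x\<close>, hence within
      \<open>2 * (t + 1)\<close> of each other.\<close>
    obtain R where R: "\<forall>x \<in> P. \<forall>y \<in> Q. d x y \<le> 2 * (t + 1) \<longrightarrow> d a x \<le> R"
      using disj by (auto simp: coarsely_disjoint_def)
    have "d a x \<le> R + t + 1" if x: "x \<in> M" "s x \<le> t" for x
    proof -
      have "sdist P x < t + 1" "sdist Q x < t + 1"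
        using x sdist_nonneg[OF P(2), of x] sdist_nonneg[OF Q(2), of x] by (auto simp: s_def)
      then obtain p q where pq: "p \<in> P" "q \<in> Q" "d x p < t + 1" "d x q < t + 1"
        using sdist_less P(2) Q(2) by metis
      have pqM: "p \<in> M" "q \<in> M" using pq P Q by auto
      have "d p q \<le> d p x + d x q" using mdist_triangle pqM x by metis
      then have "d p q \<le> 2 * (t + 1)" using pq mdist_commute[of X p x] by auto
      then have "d a p \<le> R" using R pq by blast
      then show ?thesis using tri[of p x] pq pqM x mdist_commute[of X p x] by auto
    qed
    then show ?thesis by (meson not_le)
  qed
  have f01: "0 \<le> f x \<and> f x \<le> 1" for x
    using sdist_nonneg[OF P(2), of x] sdist_nonneg[OF Q(2), of x] s1[of x]
    by (auto simp: f_def s_def divide_le_eq)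
  have "restrict f M \<in> H"
  proof (rule higsonI)
    show "continuous_map (mtopology_of X) euclideanreal f"
      unfolding f_def[abs_def] s_def[abs_def]
      by (intro continuous_intros sdist_cont P Q) auto
    show "\<bar>f x\<bar> \<le> 1" for x using f01 by simp
    fix r \<epsilon> :: real assume r: "0 < r" "0 < \<epsilon>"
    obtain R where R: "\<forall>x \<in> M. R < d a x \<longrightarrow> 3 * r / \<epsilon> < s x" using s_far by blast
    have "\<bar>f x - f y\<bar> < \<epsilon>" if xy: "x \<in> M" "y \<in> M" "R < d a x" "d x y \<le> r" for x y
    proof -
      have 1: "\<bar>sdist P x - sdist P y\<bar> \<le> r" "\<bar>sdist Q x - sdist Q y\<bar> \<le> r"
        using sdist_Lipschitz[OF P xy(1,2)] sdist_Lipschitz[OF Q xy(1,2)] xy(4) by auto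
      then have 2: "\<bar>s x - s y\<bar> \<le> 2 * r" unfolding s_def by linarith
      have pos: "s x > 0" "s y > 0" using s1[of x] s1[of y] by auto
      \<comment> \<open>The numerator changes by at most \<open>r\<close> and the denominator by at
        most \<open>2 * r\<close>; this is the source of \<open>3 * r\<close>, which the large
        factor \<open>s x\<close> absorbs.\<close>
      have eq: "s x * (f x - f y) = (sdist P x - sdist P y) - f y * (s x - s y)"
        using pos by (simp add: f_def field_simps)
      have "\<bar>f y * (s x - s y)\<bar> \<le> 1 * (2 * r)"
        unfolding abs_mult using 2 f01[of y] r by (intro mult_mono) auto
      then have "\<bar>s x * (f x - f y)\<bar> \<le> 3 * r" using 1 unfolding eq by linarith
      then have "s x * \<bar>f x - f y\<bar> \<le> 3 * r" using pos by (simp add: abs_mult)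
      moreover have "3 * r < s x * \<epsilon>" using R xy r by (auto simp: divide_less_eq)
      ultimately have "s x * \<bar>f x - f y\<bar> < s x * \<epsilon>" by simp
      then show ?thesis using pos by simp
    qed
    then show "\<exists>R. \<forall>x\<in>M. \<forall>y\<in>M. R < d a x \<longrightarrow> d x y \<le> r \<longrightarrow> \<bar>f x - f y\<bar> < \<epsilon>" by blast
  qed
  moreover have "\<forall>x \<in> P. restrict f M x = 0" using P sdist_in by (auto simp: f_def)
  moreover have "bdd {x \<in> Q. restrict f M x \<noteq> 1}"
  proof -
    obtain R where R: "\<forall>x \<in> M. R < d a x \<longrightarrow> 1 < s x" using s_far by blast
    have "d a x \<le> R" if "x \<in> Q" "restrict f M x \<noteq> 1" for x
    proof (rule ccontr)
      assume "\<not> d a x \<le> R"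
      then have "1 < s x" using R that Q by auto
      moreover have "sdist Q x = 0" using sdist_in that Q by auto
      ultimately have "s x = sdist P x" by (auto simp: s_def)
      then show False using that Q \<open>1 < s x\<close> by (auto simp: f_def)
    qed
    then show ?thesis by (intro bddI) auto
  qed
  ultimately show ?thesis by blast
qed

lemma trace_disjoint:
  assumes P: "P \<subseteq> M" and Q: "Q \<subseteq> M" and disj: "coarsely_disjoint P Q"
  shows "corona_trace P \<inter> corona_trace Q = {}"
proof (cases "P = {} \<or> Q = {}")
  case True
  then show ?thesis using trace_bdd[of "{}"] by (auto simp: bdd_def)
next
  case False
  then obtain f where f: "f \<in> H" "\<forall>x \<in> P. f x = 0" "bdd {x \<in> Q. f x \<noteq> 1}"
    using coarsely_disjoint_separate[OF P _ Q _ disj] by blast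
  have False if p: "p \<in> corona_trace P" "p \<in> corona_trace Q" for p
  proof -
    have "p f \<le> 0"
      by (rule cl_le[OF f(1) P, of 0]) (use f(2) p(1) in \<open>simp_all add: corona_trace_def\<close>)
    then have "p \<in> corona_trace {x \<in> Q. f x \<in> {..<1}}" by (intro trace_open[OF f(1) _ Q p(2)]) auto
    then have "\<not> bdd {x \<in> Q. f x \<in> {..<1}}" by (rule trace_not_bdd[rotated]) (use Q in auto)
    then show False using f(3) bdd_subset by (metis (mono_tags, lifting) Collect_mono lessThan_iff less_irrefl)
  qed
  then show ?thesis by blast
qed

text \<open>A function that separates a point of the first trace from the second trace is negative
  on an unbounded part of \<open>S\<close>. By slow oscillation it is below 1 on an unbounded part
  of \<open>T\<close>, whose limit points contradict the separation. In this way a net may replace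
  the whole space.\<close>

lemma trace_nbhd:
  assumes S: "S \<subseteq> M" and T: "T \<subseteq> M" and near: "\<And>s. s \<in> S \<Longrightarrow> \<exists>t \<in> T. d s t \<le> r"
  shows "corona_trace S \<subseteq> corona_trace T"
proof (rule ccontr)
  assume "\<not> corona_trace S \<subseteq> corona_trace T"
  then obtain p where p: "p \<in> corona_trace S" "p \<notin> corona_trace T" by blast
  have pM: "p \<in> cl M" using p trace_subset corona_subset by blast
  have pc: "closedin PT {p}"
    using pM cl_subset Hausdorff_PT by (auto simp: closedin_Hausdorff_sing_eq)
  obtain f where f: "f \<in> H" "p f < 0" "\<forall>q \<in> corona_trace T. q f > 1"
    using separate_closed[OF pc closedin_trace, of T] pM p trace_subset corona_subset by blast
  have "p \<in> corona_trace {s \<in> S. f s \<in> {..<0}}" by (rule trace_open[OF f(1) _ S p(1)]) (use f in auto)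
  then have nb: "\<not> bdd {s \<in> S. f s \<in> {..<0}}" by (rule trace_not_bdd[rotated]) (use S in auto)
  obtain R where R: "\<forall>x \<in> M. \<forall>y \<in> M. R < d a x \<longrightarrow> d x y \<le> r \<longrightarrow> \<bar>f x - f y\<bar> < 1"
    using higson_osc[OF f(1), of 1] by auto
  have "\<not> bdd {t \<in> T. f t < 1}"
  proof
    assume "bdd {t \<in> T. f t < 1}"
    then obtain R' where R': "\<forall>t \<in> {t \<in> T. f t < 1}. d a t \<le> R'" by (auto simp: bdd_def)
    obtain s where s: "s \<in> S" "f s < 0" "max R (R' + r) < d a s" using not_bddD[OF nb, of "max R (R' + r)"] by auto
    obtain t where t: "t \<in> T" "d s t \<le> r" using near s by blast
    have "f t < 1" using R s t S T by (smt (verit) max_less_iff_conj subsetD)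
    then have "d a t \<le> R'" using R' t by blast
    then show False using tri[of t s] s t S T mdist_commute[of X t s] by auto
  qed
  then obtain q where q: "q \<in> corona_trace {t \<in> T. f t < 1}" using trace_nonempty[of "{t \<in> T. f t < 1}"] T by blast
  have "q f \<le> 1"
    by (rule cl_le[OF f(1), of "{t \<in> T. f t < 1}"]) (use T q in \<open>auto simp: corona_trace_def\<close>)
  moreover have "q \<in> corona_trace T" using q trace_mono[of "{t \<in> T. f t < 1}" T] by auto
  ultimately have "1 < q f" using f(3) by blast
  with \<open>q f \<le> 1\<close> show False by simp
qed

text \<open>If the points with values in the gap were unbounded, their trace would contain a point
  with value between 0 and 1, which belongs to neither half.\<close>

lemma trace_disconnected_split:
  assumes S: "S \<subseteq> M" and C: "closedin PT C" "closedin PT D" "corona_trace S = C \<union> D" "C \<inter> D = {}"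
    "C \<noteq> {}" "D \<noteq> {}"
  shows "\<exists>f \<in> H. bdd {s \<in> S. 0 \<le> f s \<and> f s \<le> 1} \<and> \<not> bdd {s \<in> S. f s < 0} \<and> \<not> bdd {s \<in> S. 1 < f s}"
proof -
  have "C \<subseteq> cl M" "D \<subseteq> cl M" using C(3) trace_subset corona_subset by blast+
  then obtain f where f: "f \<in> H" "\<forall>p \<in> C. p f < 0" "\<forall>q \<in> D. q f > 1"
    using separate_closed[OF C(1,2)] C(4) by blast
  have "bdd {s \<in> S. 0 \<le> f s \<and> f s \<le> 1}"
  proof (rule ccontr)
    let ?B = "{s \<in> S. 0 \<le> f s \<and> f s \<le> 1}"
    assume "\<not> bdd ?B"
    then obtain p where p: "p \<in> corona_trace ?B" using trace_nonempty[of ?B] S by blast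
    have B: "?B \<subseteq> M" and pB: "p \<in> cl ?B" using S p by (auto simp: corona_trace_def)
    have "0 \<le> p f" by (rule cl_ge[OF f(1) B _ pB]) simp
    moreover have "p f \<le> 1" by (rule cl_le[OF f(1) B _ pB]) simp
    moreover have "p \<in> C \<union> D" using p trace_mono[of ?B S] C(3) by auto
    ultimately show False using f by force
  qed
  moreover have "\<not> bdd {s \<in> S. f s < 0}"
  proof -
    obtain p where "p \<in> C" using C by blast
    then have "p \<in> corona_trace {s \<in> S. f s \<in> {..<0}}" using trace_open[OF f(1) _ S, of "{..<0}" p] f C(3) by auto
    then show ?thesis using trace_not_bdd[of "{s \<in> S. f s < 0}" p] S by auto
  qed
  moreover have "\<not> bdd {s \<in> S. 1 < f s}"
  proof -
    obtain p where "p \<in> D" using C by blast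
    then have "p \<in> corona_trace {s \<in> S. f s \<in> {1<..}}" using trace_open[OF f(1) _ S, of "{1<..}" p] f C(3) by auto
    then show ?thesis using trace_not_bdd[of "{s \<in> S. 1 < f s}" p] S by auto
  qed
  ultimately show ?thesis using f(1) by blast
qed

end

section \<open>Spaces coarsely equivalent to the natural numbers\<close>

text \<open>The modulus is a supremum over pairs at distance at most \<open>r\<close>. The inserted
  0 makes the set nonempty and the supremum nonnegative.\<close>

lemma mono_modulus:
  assumes "\<And>r. \<exists>t. \<forall>x \<in> mspace X. \<forall>x' \<in> mspace X. mdist X x x' \<le> r \<longrightarrow> mdist Y (f x) (f x') \<le> t"
  shows "\<exists>\<sigma> :: real \<Rightarrow> real. \<sigma> \<in> {0..} \<rightarrow> {0..} \<and> mono_on {0..} \<sigma> \<and>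
    (\<forall>x \<in> mspace X. \<forall>x' \<in> mspace X. mdist Y (f x) (f x') \<le> \<sigma> (mdist X x x'))"
proof -
  define S where "S r = insert 0 {mdist Y (f x) (f x') |x x'. x \<in> mspace X \<and> x' \<in> mspace X \<and> mdist X x x' \<le> r}" for r
  have bdd: "bdd_above (S r)" for r
  proof -
    obtain t where t: "\<forall>x \<in> mspace X. \<forall>x' \<in> mspace X. mdist X x x' \<le> r \<longrightarrow> mdist Y (f x) (f x') \<le> t"
      using assms by blast
    show ?thesis by (rule bdd_aboveI[of _ "max 0 t"]) (use t in \<open>auto simp: S_def le_max_iff_disj\<close>)
  qed
  have up: "s \<le> Sup (S r)" if "s \<in> S r" for s r using cSup_upper[OF that bdd] .
  have "0 \<le> Sup (S r)" for r using up[of 0 r] by (simp add: S_def)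
  moreover have "mono_on {0..} (\<lambda>r. Sup (S r))"
  proof (intro mono_onI cSup_subset_mono bdd)
    show "S r \<subseteq> S s" if "r \<le> s" for r s
      unfolding S_def using that by (blast intro: order_trans)
  qed (auto simp: S_def)
  moreover have "mdist Y (f x) (f x') \<le> Sup (S (mdist X x x'))" if "x \<in> mspace X" "x' \<in> mspace X" for x x'
    by (rule up) (use that in \<open>auto simp: S_def\<close>)
  ultimately show ?thesis by (intro exI[of _ "\<lambda>r. Sup (S r)"]) auto
qed

lemma chain_dist_le:
  fixes g :: "nat \<Rightarrow> 'a"
  assumes "\<And>n. g n \<in> mspace X" "\<And>n. mdist X (g n) (g (Suc n)) \<le> r"
  shows "mdist X (g m) (g n) \<le> r * \<bar>real m - real n\<bar>"
proof -
  have *: "mdist X (g m) (g (m + k)) \<le> r * real k" for m k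
  proof (induction k)
    case 0
    have "mdist X (g m) (g m) = 0" using assms(1) by simp
    then show ?case by simp
  next
    case (Suc k)
    have "mdist X (g m) (g (m + Suc k)) \<le> mdist X (g m) (g (m + k)) + mdist X (g (m + k)) (g (Suc (m + k)))"
      using mdist_triangle assms(1) by (metis add_Suc_right)
    then show ?case using Suc assms(2)[of "m + k"] by (simp add: algebra_simps)
  qed
  show ?thesis
  proof (cases "m \<le> n")
    case True
    then show ?thesis using *[of m "n - m"] by simp
  next
    case False
    then show ?thesis using *[of n "m - n"] by (simp add: mdist_commute)
  qed
qed

lemma mspace_nat_metric [simp]: "mspace nat_metric = \<nat>"
  and mdist_nat_metric: "mdist nat_metric x y = \<bar>x - y\<bar>"
  by (simp_all add: nat_metric_def dist_real_def)

lemma bounded_in_nat_metric: "bounded_in nat_metric B \<longleftrightarrow> B \<subseteq> \<nat> \<and> (\<exists>t. \<forall>y \<in> B. y \<le> t)"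
proof -
  interpret Metric_space "\<nat> :: real set" "mdist nat_metric"
    using Metric_space_mspace_mdist[of nat_metric] by simp
  show ?thesis
  proof
    assume "bounded_in nat_metric B"
    then obtain c r where B: "B \<subseteq> mcball c r" by (auto simp: bounded_in_def mbounded_def)
    have "y \<le> c + r" if "y \<in> B" for y
    proof -
      have "\<bar>c - y\<bar> \<le> r" using B that by (auto simp: mdist_nat_metric)
      then show ?thesis by linarith
    qed
    then show "B \<subseteq> \<nat> \<and> (\<exists>t. \<forall>y \<in> B. y \<le> t)" using B by auto
  next
    assume B: "B \<subseteq> \<nat> \<and> (\<exists>t. \<forall>y \<in> B. y \<le> t)"
    then obtain t where t: "\<forall>y \<in> B. y \<le> t" by blast
    have "y \<in> mcball 0 t" if "y \<in> B" for y
    proof -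
      have "y \<in> \<nat>" "y \<le> t" using B t that by auto
      then show ?thesis by (auto simp: mdist_nat_metric elim!: Nats_cases)
    qed
    then have "mbounded B" unfolding mbounded_def by blast
    then show "bounded_in nat_metric B" by (simp add: bounded_in_def)
  qed
qed

context proper_unbounded
begin

section \<open>Coordinates along a ray\<close>

text \<open>A coarse equivalence \<open>h\<close> with quasi-inverse \<open>g\<close>, using true
  natural numbers in place of reals. Control of \<open>g\<close> reduces to consecutive points, and
  boundedness of preimages is recovered from the listed estimates.\<close>

definition ray_coordinates :: "('a \<Rightarrow> nat) \<Rightarrow> (nat \<Rightarrow> 'a) \<Rightarrow> bool" where
  "ray_coordinates h g \<longleftrightarrow>
     (\<forall>n. g n \<in> M) \<and>
     (\<forall>r. \<exists>t. \<forall>x \<in> M. \<forall>y \<in> M. d x y \<le> r \<longrightarrow> \<bar>real (h x) - real (h y)\<bar> \<le> t) \<and>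
     (\<exists>r. \<forall>n. d (g n) (g (Suc n)) \<le> r) \<and>
     (\<exists>r. \<forall>x \<in> M. d x (g (h x)) \<le> r) \<and>
     (\<exists>c. \<forall>n. \<bar>real (h (g n)) - real n\<bar> \<le> c)"

lemma ray_coordinatesE:
  assumes "ray_coordinates h g"
  obtains r1 r2 c where "\<And>n. d (g n) (g (Suc n)) \<le> r1" "\<And>x. x \<in> M \<Longrightarrow> d x (g (h x)) \<le> r2"
    "\<And>n. \<bar>real (h (g n)) - real n\<bar> \<le> c" "\<And>n. g n \<in> M"
  using assms unfolding ray_coordinates_def by blast

text \<open>Go from \<open>x\<close> to \<open>g (h x)\<close>, along the chain to
  \<open>g (h y)\<close>, and from there to \<open>y\<close>.\<close>

lemma ray_coordinates_expansive:
  assumes "ray_coordinates h g"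
  shows "\<exists>r. \<forall>x \<in> M. \<forall>y \<in> M. \<bar>real (h x) - real (h y)\<bar> \<le> t \<longrightarrow> d x y \<le> r"
proof -
  obtain r1 r2 where r: "\<And>n. d (g n) (g (Suc n)) \<le> r1" "\<And>x. x \<in> M \<Longrightarrow> d x (g (h x)) \<le> r2"
    and g: "\<And>n. g n \<in> M"
    using ray_coordinatesE[OF assms] by metis
  have r1: "0 \<le> r1" using r(1)[of 0] mdist_nonneg[of X "g 0" "g (Suc 0)"] by linarith
  have "d x y \<le> r2 + r1 * t + r2" if xy: "x \<in> M" "y \<in> M" "\<bar>real (h x) - real (h y)\<bar> \<le> t" for x y
  proof -
    have "d x y \<le> d x (g (h x)) + d (g (h x)) y" using mdist_triangle g xy by metis
    also have "d (g (h x)) y \<le> d (g (h x)) (g (h y)) + d (g (h y)) y" using mdist_triangle g xy by metis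
    also have "d (g (h x)) (g (h y)) \<le> r1 * \<bar>real (h x) - real (h y)\<bar>" using chain_dist_le[of g, OF g r(1)] .
    also have "r1 * \<bar>real (h x) - real (h y)\<bar> \<le> r1 * t" using xy r1 by (intro mult_left_mono)
    finally show ?thesis using r(2)[of x] r(2)[of y] xy mdist_commute[of X y] by auto
  qed
  then show ?thesis by blast
qed

lemma ray_coordinates_of_coarse_equivalence:
  assumes "coarsely_equivalent X nat_metric"
  shows "\<exists>h g. ray_coordinates h g"
proof -
  obtain f G where f: "coarse_map X nat_metric f" and G: "coarse_map nat_metric X G"
    and cl: "close_maps X X (G \<circ> f) id" "close_maps nat_metric nat_metric (f \<circ> G) id"
    using assms by (auto simp: coarsely_equivalent_def coarse_equivalence_def)
  obtain \<sigma> where \<sigma>: "mono_on {0..} \<sigma>" "\<And>x x'. x \<in> M \<Longrightarrow> x' \<in> M \<Longrightarrow> \<bar>f x - f x'\<bar> \<le> \<sigma> (d x x')"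
    and fM: "\<And>x. x \<in> M \<Longrightarrow> f x \<in> \<nat>"
    using f by (fastforce simp: coarse_map_def mdist_nat_metric)
  obtain \<tau> where \<tau>: "\<And>y y'. y \<in> \<nat> \<Longrightarrow> y' \<in> \<nat> \<Longrightarrow> d (G y) (G y') \<le> \<tau> \<bar>y - y'\<bar>"
    and GM: "\<And>y. y \<in> \<nat> \<Longrightarrow> G y \<in> M"
    using G by (fastforce simp: coarse_map_def mdist_nat_metric)
  obtain r1 where r1: "\<And>x. x \<in> M \<Longrightarrow> d (G (f x)) x < r1"
    using cl(1) by (auto simp: close_maps_def)
  obtain r2 where r2: "\<And>y. y \<in> \<nat> \<Longrightarrow> \<bar>f (G y) - y\<bar> < r2"
    using cl(2) by (auto simp: close_maps_def mdist_nat_metric)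
  \<comment> \<open>The values of \<open>f\<close> on \<open>M\<close> are natural numbers already;
    the floor only changes the type.\<close>
  define h where "h x = nat \<lfloor>f x\<rfloor>" for x
  define g where "g n = G (real n)" for n
  have h: "real (h x) = f x" if "x \<in> M" for x
    using fM[OF that] by (auto simp: h_def elim!: Nats_cases)
  have gM: "g n \<in> M" for n using GM by (simp add: g_def)
  have "\<exists>t. \<forall>x \<in> M. \<forall>y \<in> M. d x y \<le> r \<longrightarrow> \<bar>real (h x) - real (h y)\<bar> \<le> t" for r
  proof (intro exI ballI impI)
    fix x y assume xy: "x \<in> M" "y \<in> M" "d x y \<le> r"
    have "\<bar>f x - f y\<bar> \<le> \<sigma> (d x y)" using \<sigma>(2) xy by blast
    also have "\<dots> \<le> \<sigma> r"
      using xy order_trans[OF mdist_nonneg[of X x y]] by (intro mono_onD[OF \<sigma>(1)]) auto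
    finally show "\<bar>real (h x) - real (h y)\<bar> \<le> \<sigma> r" using h xy by simp
  qed
  moreover have "d (g n) (g (Suc n)) \<le> \<tau> 1" for n
    using \<tau>[of "real n" "real (Suc n)"] by (simp add: g_def)
  moreover have "d x (g (h x)) \<le> r1" if "x \<in> M" for x
    using r1[OF that] h[OF that] mdist_commute[of X x] by (simp add: g_def less_imp_le)
  moreover have "\<bar>real (h (g n)) - real n\<bar> \<le> r2" for n
    using r2[of "real n"] h[OF gM, of n] by (simp add: g_def less_imp_le)
  ultimately have "ray_coordinates h g" unfolding ray_coordinates_def using gM by blast
  then show ?thesis by blast
qed

lemma coarse_equivalence_of_ray_coordinates:
  assumes hg: "ray_coordinates h g"
  shows "coarsely_equivalent X nat_metric"
proof -
  define f where "f x = real (h x)" for x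
  define G where "G y = g (nat \<lfloor>y\<rfloor>)" for y :: real
  have gM: "g n \<in> M" for n using hg by (simp add: ray_coordinates_def)
  obtain r1 r2 c where r1: "\<And>n. d (g n) (g (Suc n)) \<le> r1"
    and r2: "\<And>x. x \<in> M \<Longrightarrow> d x (g (h x)) \<le> r2" and c: "\<And>n. \<bar>real (h (g n)) - real n\<bar> \<le> c"
    using ray_coordinatesE[OF hg] by metis
  have r1': "0 \<le> r1" using r1[of 0] mdist_nonneg[of X "g 0" "g (Suc 0)"] by linarith
  have hb: "\<exists>t. \<forall>x \<in> M. \<forall>y \<in> M. d x y \<le> r \<longrightarrow> \<bar>f x - f y\<bar> \<le> t" for r
    using hg by (simp add: ray_coordinates_def f_def)
  have "coarse_map X nat_metric f"
    unfolding coarse_map_def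
  proof (intro conjI allI impI)
    show "f \<in> M \<rightarrow> mspace nat_metric" by (auto simp: f_def)
    show "\<exists>\<sigma>. \<sigma> \<in> {0..} \<rightarrow> {0..} \<and> mono_on {0..} \<sigma> \<and>
        (\<forall>x\<in>M. \<forall>x'\<in>M. mdist nat_metric (f x) (f x') \<le> \<sigma> (d x x'))"
      using mono_modulus[of X nat_metric f] hb by (simp add: mdist_nat_metric)
    fix B assume "bounded_in nat_metric B"
    then obtain t where t: "\<forall>y \<in> B. y \<le> t" by (auto simp: bounded_in_nat_metric)
    obtain r where r: "\<forall>x \<in> M. \<forall>y \<in> M. \<bar>real (h x) - real (h y)\<bar> \<le> \<bar>t\<bar> + real (h a) \<longrightarrow> d x y \<le> r"
      using ray_coordinates_expansive[OF hg] by blast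
    have "d a x \<le> r" if "x \<in> f -` B \<inter> M" for x
    proof -
      have "real (h x) \<le> t" "x \<in> M" using that t by (auto simp: f_def)
      then show ?thesis using r base by auto
    qed
    then show "bounded_in X (f -` B \<inter> M)" unfolding bounded_in_iff using bddI by blast
  qed
  moreover have "coarse_map nat_metric X G"
    unfolding coarse_map_def
  proof (intro conjI allI impI)
    show "G \<in> mspace nat_metric \<rightarrow> M" using gM by (auto simp: G_def)
    have "d (G y) (G y') \<le> r1 * \<bar>y - y'\<bar>" if "y \<in> \<nat>" "y' \<in> \<nat>" for y y'
      using that chain_dist_le[of g X r1, OF gM r1] by (auto simp: G_def elim!: Nats_cases)
    then show "\<exists>\<sigma>. \<sigma> \<in> {0..} \<rightarrow> {0..} \<and> mono_on {0..} \<sigma> \<and>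
        (\<forall>x\<in>mspace nat_metric. \<forall>x'\<in>mspace nat_metric. d (G x) (G x') \<le> \<sigma> (mdist nat_metric x x'))"
      using r1' by (intro exI[of _ "\<lambda>t. r1 * t"])
        (auto simp: mdist_nat_metric mono_on_def intro: mult_left_mono)
    fix B assume "bounded_in X B"
    then obtain R where R: "B \<subseteq> M" "\<forall>x \<in> B. d a x \<le> R" by (auto simp: bounded_in_iff bdd_def)
    obtain t where t: "\<forall>x \<in> M. \<forall>y \<in> M. d x y \<le> R \<longrightarrow> \<bar>f x - f y\<bar> \<le> t" using hb by blast
    have "y \<le> f a + t + c" if y: "y \<in> G -` B \<inter> \<nat>" for y
    proof -
      obtain n where n: "y = real n" "g n \<in> B" using y by (auto simp: G_def elim!: Nats_cases)
      then have "\<bar>f a - f (g n)\<bar> \<le> t" using t R base by blast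
      then show ?thesis using c[of n] n by (simp add: f_def) 
    qed
    then show "bounded_in nat_metric (G -` B \<inter> mspace nat_metric)"
      unfolding bounded_in_nat_metric by auto
  qed
  moreover have "close_maps X X (G \<circ> f) id"
  proof -
    have "d (G (f x)) x < max r2 0 + 1" if "x \<in> M" for x
      using r2[OF that] mdist_commute[of X x] by (simp add: G_def f_def)
    then show ?thesis unfolding close_maps_def by (intro exI[of _ "max r2 0 + 1"]) auto
  qed
  moreover have "close_maps nat_metric nat_metric (f \<circ> G) id"
  proof -
    have "\<bar>f (G y) - y\<bar> < max c 0 + 1" if y: "y \<in> \<nat>" for y
    proof -
      obtain n where "y = real n" using y by (auto elim!: Nats_cases)
      then show ?thesis using c[of n] by (simp add: f_def G_def)
    qed
    then show ?thesis unfolding close_maps_def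
      by (intro exI[of _ "max c 0 + 1"]) (auto simp: mdist_nat_metric)
  qed
  ultimately show ?thesis unfolding coarsely_equivalent_def coarse_equivalence_def by blast
qed

section \<open>Connectedness inside the corona\<close>

lemma connectedin_corona_iff: "S \<subseteq> corona \<Longrightarrow> connectedin (higson_corona X) S \<longleftrightarrow> connectedin PT S"
  by (simp add: higson_corona_eq connectedin_subtopology)

lemma continuum_corona_iff: "continuum (higson_corona X) \<longleftrightarrow> connectedin PT corona"
proof -
  have "compact_space (higson_corona X)"
    unfolding higson_corona_eq
    using closedin_compact_space[OF compact_PT closedin_corona] by (rule compact_space_subtopology)
  moreover have "Hausdorff_space (higson_corona X)"
    unfolding higson_corona_eq by (rule Hausdorff_space_subtopology[OF Hausdorff_PT])
  moreover have "corona \<noteq> {}"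
    using trace_nonempty[of M] not_bdd_space trace_M by auto
  moreover have "connected_space (higson_corona X) \<longleftrightarrow> connectedin PT corona"
    using connectedin_corona_iff[of corona] connectedin_topspace[of "higson_corona X"]
    by (simp add: topspace_corona)
  ultimately show ?thesis by (simp add: continuum_def topspace_corona)
qed

lemma subcontinuum_corona:
  assumes "subcontinuum (higson_corona X) S"
  shows "S \<subseteq> corona \<and> closedin PT S \<and> connectedin PT S"
proof -
  have S: "S \<subseteq> corona" "compact_space (subtopology (higson_corona X) S)" "connected_space (subtopology (higson_corona X) S)"
    using assms by (auto simp: subcontinuum_def continuum_def topspace_corona)
  then have "compactin (higson_corona X) S" "connectedin (higson_corona X) S"
    by (auto simp: compactin_subspace connectedin_def topspace_corona)
  then have "compactin PT S" "connectedin PT S"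
    by (auto simp: higson_corona_eq compactin_subtopology connectedin_subtopology)
  then show ?thesis using S(1) Hausdorff_PT compactin_imp_closedin by blast
qed

lemma trace_connectedI:
  assumes S: "S \<subseteq> M"
    and f: "\<And>f. f \<in> H \<Longrightarrow> bdd {s \<in> S. 0 \<le> f s \<and> f s \<le> 1} \<Longrightarrow> bdd {s \<in> S. f s < 0} \<or> bdd {s \<in> S. 1 < f s}"
  shows "connectedin PT (corona_trace S)"
proof (rule ccontr)
  have sub: "corona_trace S \<subseteq> topspace PT" using closedin_subset[OF closedin_trace] .
  assume "\<not> connectedin PT (corona_trace S)"
  then obtain C D where CD: "closedin PT C" "closedin PT D" "corona_trace S \<subseteq> C \<union> D"
    "C \<inter> D \<inter> corona_trace S = {}" "C \<inter> corona_trace S \<noteq> {}" "D \<inter> corona_trace S \<noteq> {}"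
    unfolding connectedin_closedin using sub by blast
  have "closedin PT (C \<inter> corona_trace S)" "closedin PT (D \<inter> corona_trace S)"
    using CD(1,2) closedin_trace by blast+
  moreover have "corona_trace S = (C \<inter> corona_trace S) \<union> (D \<inter> corona_trace S)" "(C \<inter> corona_trace S) \<inter> (D \<inter> corona_trace S) = {}"
    using CD(3,4) by auto
  ultimately have "\<exists>f \<in> H. bdd {s \<in> S. 0 \<le> f s \<and> f s \<le> 1} \<and> \<not> bdd {s \<in> S. f s < 0} \<and> \<not> bdd {s \<in> S. 1 < f s}"
    using CD(5,6) by (intro trace_disconnected_split[OF S])
  then show False using f by blast
qed

lemma connectedin_trace_split:
  assumes "connectedin PT T" "P \<subseteq> M" "Q \<subseteq> M" "coarsely_disjoint P Q"
    "T \<subseteq> corona_trace P \<union> corona_trace Q" "T \<inter> corona_trace P \<noteq> {}" "T \<inter> corona_trace Q \<noteq> {}"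
  shows False
proof -
  have disj: "corona_trace P \<inter> corona_trace Q = {}" by (rule trace_disjoint[OF assms(2-4)])
  have "corona_trace P \<inter> corona_trace Q \<inter> T = {}" "corona_trace P \<inter> T \<noteq> {}" "corona_trace Q \<inter> T \<noteq> {}"
    using disj assms(6,7) by (simp_all add: Int_commute)
  then show False
    using assms(1)[unfolded connectedin_closedin] assms(5) closedin_trace by metis
qed

section \<open>The corona of a coarse ray\<close>

lemma ray_coordinate_unbounded:
  assumes hg: "ray_coordinates h g" and S: "S \<subseteq> M" "\<not> bdd S"
  shows "\<exists>s \<in> S. n < h s"
proof -
  obtain r where r: "\<forall>x \<in> M. \<forall>y \<in> M. \<bar>real (h x) - real (h y)\<bar> \<le> real (h a + n) \<longrightarrow> d x y \<le> r"
    using ray_coordinates_expansive[OF hg] by blast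
  obtain s where s: "s \<in> S" "r < d a s" using not_bddD[OF S(2)] by blast
  have "\<not> h s \<le> n"
  proof
    assume "h s \<le> n"
    then have "\<bar>real (h a) - real (h s)\<bar> \<le> real (h a + n)" by simp
    then show False using r s S base by fastforce
  qed
  then show ?thesis using s by (auto intro: bexI[of _ s])
qed

lemma ray_coordinate_bounded:
  assumes hg: "ray_coordinates h g" and S: "S \<subseteq> M" "bdd S"
  shows "\<exists>n. \<forall>s \<in> S. h s \<le> n"
proof -
  obtain R where R: "\<forall>s \<in> S. d a s \<le> R" using S by (auto simp: bdd_def)
  obtain t where t: "\<forall>x \<in> M. \<forall>y \<in> M. d x y \<le> R \<longrightarrow> \<bar>real (h x) - real (h y)\<bar> \<le> t"
    using hg unfolding ray_coordinates_def by blast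
  have "h s \<le> nat \<lceil>real (h a) + t\<rceil>" if "s \<in> S" for s
  proof -
    have "\<bar>real (h a) - real (h s)\<bar> \<le> t" using R t that S base by blast
    then show ?thesis by linarith
  qed
  then show ?thesis by blast
qed

text \<open>Far out, a function with bounded gap takes no value in the gap, yet it changes by less
  than 1 along the chain. Its sign on the chain is thus eventually constant, and it is passed on to
  every far point through the nearby \<open>g (h x)\<close>.\<close>

lemma ray_corona_connected:
  assumes hg: "ray_coordinates h g"
  shows "connectedin PT corona"
  unfolding trace_M[symmetric]
proof (rule trace_connectedI)
  fix f assume f: "f \<in> H" "bdd {s \<in> M. 0 \<le> f s \<and> f s \<le> 1}"
  obtain r1 r2 c where r1: "\<And>n. d (g n) (g (Suc n)) \<le> r1"
    and r2: "\<And>x. x \<in> M \<Longrightarrow> d x (g (h x)) \<le> r2" and c: "\<And>n. \<bar>real (h (g n)) - real n\<bar> \<le> c"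
    and gM: "\<And>n. g n \<in> M"
    using ray_coordinatesE[OF hg] by metis
  obtain R1 where R1: "\<forall>s \<in> {s \<in> M. 0 \<le> f s \<and> f s \<le> 1}. d a s \<le> R1" using f(2) by (auto simp: bdd_def)
  obtain R2 where R2: "\<forall>x \<in> M. \<forall>y \<in> M. R2 < d a x \<longrightarrow> d x y \<le> max r1 r2 \<longrightarrow> \<bar>f x - f y\<bar> < 1"
    using higson_osc[OF f(1), of 1 "max r1 r2"] by auto
  define R where "R = max R1 R2"
  obtain N0 where N0: "\<forall>s \<in> {x \<in> M. d a x \<le> R}. h s \<le> N0"
    using ray_coordinate_bounded[OF hg, of "{x \<in> M. d a x \<le> R}"] by (auto simp: bdd_def)
  \<comment> \<open>As \<open>h (g n)\<close> differs from \<open>n\<close> by at most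
    \<open>c\<close>, every \<open>n \<ge> N\<close> has \<open>h (g n) > N0\<close> and hence
    \<open>g n\<close> outside the ball of radius \<open>R\<close>.\<close>
  define N where "N = nat \<lceil>real N0 + c\<rceil> + 1"
  have far: "R < d a (g n)" if "n \<ge> N" for n
  proof (rule ccontr)
    assume "\<not> R < d a (g n)"
    then have "h (g n) \<le> N0" using N0 gM by auto
    then show False using c[of n] that unfolding N_def by linarith
  qed
  have same: "f (g n) < 0 \<longleftrightarrow> f (g (Suc n)) < 0" if n: "n \<ge> N" for n
  proof -
    have "\<bar>f (g n) - f (g (Suc n))\<bar> < 1" using R2 far[OF n] gM r1[of n] by (auto simp: R_def)
    moreover have "\<not> (0 \<le> f (g n) \<and> f (g n) \<le> 1)" "\<not> (0 \<le> f (g (Suc n)) \<and> f (g (Suc n)) \<le> 1)"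
      using R1 far[OF n] far[of "Suc n"] n gM by (force simp: R_def)+
    ultimately show ?thesis by linarith
  qed
  have const: "f (g n) < 0 \<longleftrightarrow> f (g N) < 0" if "n \<ge> N" for n
    using that by (induction n rule: dec_induct) (use same in blast)+
  have near: "\<bar>f x - f (g (h x))\<bar> < 1" if "x \<in> M" "R < d a x" for x
    using R2 that gM r2[of x] by (auto simp: R_def)
  have far_val: "\<not> (0 \<le> f x \<and> f x \<le> 1)" if "x \<in> M" "R < d a x" for x
    using R1 that by (force simp: R_def)
  have bnd: "bdd {s \<in> S. h s \<le> N}" if S: "S \<subseteq> M" for S
    using ray_coordinate_unbounded[OF hg, of "{s \<in> S. h s \<le> N}" N] S by auto
  show "bdd {s \<in> M. f s < 0} \<or> bdd {s \<in> M. 1 < f s}"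
  proof (cases "f (g N) < 0")
    case True
    have "{s \<in> M. 1 < f s} \<subseteq> {s \<in> M. h s \<le> N} \<union> {s \<in> M. d a s \<le> R}"
    proof (rule subsetI, rule ccontr)
      fix s assume s: "s \<in> {s \<in> M. 1 < f s}" "s \<notin> {s \<in> M. h s \<le> N} \<union> {s \<in> M. d a s \<le> R}"
      then have "f (g (h s)) < 0" "\<bar>f s - f (g (h s))\<bar> < 1" using const[of "h s"] near[of s] True by auto
      then show False using s by auto
    qed
    moreover have "bdd ({s \<in> M. h s \<le> N} \<union> {s \<in> M. d a s \<le> R})" using bnd[of M] by (auto simp: bdd_def[of "{s \<in> M. d a s \<le> R}"])
    ultimately show ?thesis using bdd_subset by blast
  next
    case False
    have "{s \<in> M. f s < 0} \<subseteq> {s \<in> M. h s \<le> N} \<union> {s \<in> M. d a s \<le> R}"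
    proof (rule subsetI, rule ccontr)
      fix s assume s: "s \<in> {s \<in> M. f s < 0}" "s \<notin> {s \<in> M. h s \<le> N} \<union> {s \<in> M. d a s \<le> R}"
      then have 1: "\<not> f (g (h s)) < 0" "\<bar>f s - f (g (h s))\<bar> < 1" "h s \<ge> N"
        using const[of "h s"] near[of s] False by auto
      then have "0 \<le> f (g (h s)) \<and> f (g (h s)) \<le> 1" using s by auto
      then show False using far_val[of "g (h s)"] gM far 1(3) by blast
    qed
    moreover have "bdd ({s \<in> M. h s \<le> N} \<union> {s \<in> M. d a s \<le> R})" using bnd[of M] by (auto simp: bdd_def[of "{s \<in> M. d a s \<le> R}"])
    ultimately show ?thesis using bdd_subset by blast
  qed
qed simp

text \<open>Besides the function that exceeds 1 at the cutting points, a second one is needed to see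
  that both families of blocks meet \<open>A\<close>: it is negative on \<open>B\<close> and large
  near a point of \<open>A\<close> outside \<open>B\<close>. The points \<open>y n\<close> where it
  is large are chosen between consecutive cutting points \<open>x n\<close>.\<close>

lemma ray_corona_closed_disconnected:
  assumes hg: "ray_coordinates h g"
    and A: "closedin PT A" "A \<subseteq> corona" and B: "closedin PT B" "B \<subseteq> corona"
    and AB: "A \<union> B = corona" "A \<noteq> corona" "B \<noteq> corona"
  shows "\<not> connectedin PT A"
proof
  assume conA: "connectedin PT A"
  obtain p q where p: "p \<in> corona" "p \<notin> A" and q: "q \<in> corona" "q \<notin> B" using AB A B by blast
  have qA: "q \<in> A" using q AB by blast
  have sing: "closedin PT {p}" "closedin PT {q}"
    using p q Hausdorff_PT corona_subset cl_subset by (auto simp: closedin_Hausdorff_sing_eq)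
  obtain f where f: "f \<in> H" "\<forall>r \<in> A. r f < 0" "p f > 1"
    using separate_closed[OF A(1) sing(1)] A(2) p corona_subset by auto
  obtain k where k: "k \<in> H" "\<forall>r \<in> B. r k < 0" "q k > 1"
    using separate_closed[OF B(1) sing(2)] B(2) q corona_subset by auto
  define F where "F = {x \<in> M. f x \<in> {1<..}}"
  \<comment> \<open>Here \<open>f x < 0\<close> places the points in the set \<open>C\<close> to be
    split, and \<open>k x > 1\<close> keeps their limit points off \<open>B\<close>.\<close>
  define G where "G = {x \<in> {x \<in> M. k x \<in> {1<..}}. f x \<in> {..<0}}"
  have "p \<in> corona_trace F"
    unfolding F_def by (rule trace_open[OF f(1)]) (use p f trace_M in auto)
  then have F: "F \<subseteq> M" "\<not> bdd F" using trace_not_bdd[of F p] by (auto simp: F_def)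
  have "q \<in> corona_trace {x \<in> M. k x \<in> {1<..}}"
    by (rule trace_open[OF k(1)]) (use q k trace_M in auto)
  then have "q \<in> corona_trace G"
    unfolding G_def by (intro trace_open[OF f(1)]) (use qA f in auto)
  then have G: "G \<subseteq> M" "\<not> bdd G" using trace_not_bdd[of G q] by (auto simp: G_def)
  define good where "good z \<longleftrightarrow> fst z \<in> F \<and> snd z \<in> G \<and> h (fst z) < h (snd z)" for z
  have ex: "\<exists>z. good z \<and> n < h (fst z)" for n
  proof -
    obtain x where x: "x \<in> F" "n < h x" using ray_coordinate_unbounded[OF hg F] by blast
    obtain y where y: "y \<in> G" "h x < h y" using ray_coordinate_unbounded[OF hg G] by blast
    show ?thesis using x y by (intro exI[of _ "(x, y)"]) (simp add: good_def)
  qed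
  have "\<exists>z. \<forall>n. good (z n) \<and> h (snd (z n)) < h (fst (z (Suc n)))"
    using dependent_nat_choice[of "\<lambda>_. good" "\<lambda>_ z z'. h (snd z) < h (fst z')"] ex by metis
  then obtain z where z: "\<And>n. good (z n)" "\<And>n. h (snd (z n)) < h (fst (z (Suc n)))" by blast
  define x where "x n = fst (z n)" for n
  define y where "y n = snd (z n)" for n
  have xF: "x n \<in> F" and yG: "y n \<in> G" and xy: "h (x n) < h (y n)" and yx: "h (y n) < h (x (Suc n))" for n
    using z[of n] by (auto simp: x_def y_def good_def)
  have "strict_mono (\<lambda>n. h (x n))"
    by (rule strict_monoI_Suc) (use xy yx less_trans in blast)
  then have xmono: "h (x m) \<le> h (x n)" if "m \<le> n" for m n
    using strict_mono_less_eq[OF \<open>strict_mono (\<lambda>n. h (x n))\<close>, of m n] that by simp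
  have ygrow: "n \<le> h (y n)" for n
    using strict_mono_imp_increasing[OF \<open>strict_mono (\<lambda>n. h (x n))\<close>, of n] xy[of n] by simp
  define C where "C = {x \<in> M. f x \<in> {..<0}}"
  define C0 where "C0 = {c \<in> C. \<exists>n. h (x (2 * n)) < h c \<and> h c \<le> h (x (Suc (2 * n)))}"
  \<comment> \<open>This contains the odd blocks and also the initial segment up to
    \<open>x 0\<close>.\<close>
  define C1 where "C1 = C - C0"
  have CM: "C0 \<subseteq> M" "C1 \<subseteq> M" by (auto simp: C0_def C1_def C_def)
  have "coarsely_disjoint C0 C1"
    unfolding coarsely_disjoint_def
  proof
    fix r
    obtain t where t: "\<forall>x \<in> M. \<forall>y \<in> M. d x y \<le> r \<longrightarrow> \<bar>real (h x) - real (h y)\<bar> \<le> t"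
      using hg unfolding ray_coordinates_def by blast
    obtain r' where r': "\<forall>x \<in> M. \<forall>y \<in> M. \<bar>real (h x) - real (h y)\<bar> \<le> t \<longrightarrow> d x y \<le> r'"
      using ray_coordinates_expansive[OF hg] by blast
    obtain R where R: "\<forall>x \<in> M. \<forall>y \<in> M. R < d a x \<longrightarrow> d x y \<le> r' \<longrightarrow> \<bar>f x - f y\<bar> < 1"
      using higson_osc[OF f(1), of 1 r'] by auto
    have "d a c \<le> R" if c: "c \<in> C0" "c' \<in> C1" "d c c' \<le> r" for c c'
    proof (rule ccontr)
      assume nR: "\<not> d a c \<le> R"
      have cM: "c \<in> M" "c' \<in> M" using c CM by auto
      obtain n where n: "h (x (2 * n)) < h c" "h c \<le> h (x (Suc (2 * n)))" using c by (auto simp: C0_def)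
      have n': "h c' \<le> h (x (2 * n)) \<or> h (x (Suc (2 * n))) < h c'"
        using c(2) by (auto simp: C0_def C1_def not_less)
      have "\<bar>real (h c) - real (h c')\<bar> \<le> t" using t cM c(3) by blast
      \<comment> \<open>An end of the block of \<open>c\<close> lies between the coordinates of
        \<open>c\<close> and \<open>c'\<close>, so a cutting point is within bounded distance of
        \<open>c\<close>. There \<open>f\<close> exceeds 1 while \<open>f c < 0\<close>, which is
        impossible far out.\<close>
      then have "\<exists>m. \<bar>real (h c) - real (h (x m))\<bar> \<le> t"
        using n n' by (elim disjE) (rule exI[of _ "2 * n"], linarith, rule exI[of _ "Suc (2 * n)"], linarith)
      then obtain m where m: "\<bar>real (h c) - real (h (x m))\<bar> \<le> t" by blast
      have xM: "x m \<in> M" and fx: "1 < f (x m)" using xF[of m] by (auto simp: F_def)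
      have "\<bar>f c - f (x m)\<bar> < 1" using R r' m cM xM nR by auto
      moreover have "f c < 0" using c(1) by (auto simp: C0_def C_def)
      ultimately show False using fx by simp
    qed
    then show "\<exists>R. \<forall>x\<in>C0. \<forall>y\<in>C1. d x y \<le> r \<longrightarrow> d a x \<le> R" by blast
  qed
  moreover have "A \<subseteq> corona_trace C0 \<union> corona_trace C1"
  proof -
    have "A \<subseteq> corona_trace C"
      unfolding C_def using trace_open[OF f(1), of "{..<0}" M] f(2) A(2) trace_M by auto
    moreover have "C = C0 \<union> C1" by (auto simp: C1_def C0_def)
    ultimately show ?thesis using trace_Un by metis
  qed
  \<comment> \<open>At a limit point of the chosen \<open>y\<close> in the corona \<open>k\<close>
    is at least 1, so the point is not in \<open>B\<close> and must be in \<open>A\<close>.\<close>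
  moreover have meet: "A \<inter> corona_trace D \<noteq> {}" if \<phi>: "\<And>n. n \<le> \<phi> n" and D: "\<And>n. y (\<phi> n) \<in> D" for \<phi> :: "nat \<Rightarrow> nat" and D
  proof -
    define Y where "Y = range (\<lambda>n. y (\<phi> n))"
    have YG: "Y \<subseteq> G" using yG by (auto simp: Y_def)
    then have YM: "Y \<subseteq> M" using G(1) by blast
    have "\<not> bdd Y"
    proof
      assume "bdd Y"
      then obtain n where n: "\<forall>s \<in> Y. h s \<le> n" using ray_coordinate_bounded[OF hg YM] by blast
      have "h (y (\<phi> (Suc n))) \<le> n" using n by (auto simp: Y_def)
      then show False using ygrow[of "\<phi> (Suc n)"] \<phi>[of "Suc n"] by linarith
    qed
    then obtain w where w: "w \<in> corona_trace Y" using trace_nonempty YM by blast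
    have "1 \<le> w k"
      by (rule cl_ge[OF k(1) YM]) (use YG w in \<open>auto simp: G_def corona_trace_def\<close>)
    then have "w \<notin> B" using k(2) by force
    moreover have "w \<in> corona" using w trace_subset by blast
    ultimately have "w \<in> A" using AB by blast
    moreover have "w \<in> corona_trace D" using w trace_mono[of Y D] D by (auto simp: Y_def)
    ultimately show ?thesis by blast
  qed
  moreover have "y (2 * n) \<in> C0" for n
    using yG[of "2 * n"] xy[of "2 * n"] yx[of "2 * n"]
    by (auto simp: C0_def C_def G_def intro!: exI[of _ n])
  then have "A \<inter> corona_trace C0 \<noteq> {}" using meet[of "\<lambda>n. 2 * n" C0] by auto
  moreover have "y (Suc (2 * n)) \<in> C1" for n
  proof -
    have "\<not> (h (x (2 * m)) < h (y (Suc (2 * n))) \<and> h (y (Suc (2 * n))) \<le> h (x (Suc (2 * m))))" for m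
    proof (cases "m \<le> n")
      case True
      then show ?thesis using xmono[of "Suc (2 * m)" "Suc (2 * n)"] xy[of "Suc (2 * n)"] by simp
    next
      case False
      then show ?thesis using xmono[of "Suc (Suc (2 * n))" "2 * m"] yx[of "Suc (2 * n)"] by simp
    qed
    then show ?thesis using yG[of "Suc (2 * n)"] by (auto simp: C1_def C0_def C_def G_def)
  qed
  then have "A \<inter> corona_trace C1 \<noteq> {}" using meet[of "\<lambda>n. Suc (2 * n)" C1] by auto
  ultimately show False using connectedin_trace_split[OF conA CM] by blast
qed

lemma ray_corona_indecomposable:
  assumes hg: "ray_coordinates h g"
  shows "indecomposable_continuum (higson_corona X)"
  unfolding indecomposable_continuum_def continuum_corona_iff
proof
  show "connectedin PT corona" by (rule ray_corona_connected[OF hg])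
  show "\<not> decomposable (higson_corona X)"
    using ray_corona_closed_disconnected[OF hg] subcontinuum_corona topspace_corona
    unfolding decomposable_def by metis
qed

end

section \<open>Nets as graphs\<close>

lemma relpowp_chain:
  assumes "\<And>i. i < k \<Longrightarrow> E (b i) (b (Suc i))"
  shows "(E ^^ k) (b 0) (b k)"
  using assms by (induction k) (auto intro!: relpowp_Suc_I)

lemma relpowp_crossing:
  assumes "(E ^^ n) x y" "x \<in> P" "y \<notin> P"
  shows "\<exists>m \<le> n. \<exists>u v. (E ^^ m) x u \<and> E u v \<and> u \<in> P \<and> v \<notin> P"
  using assms
proof (induction n arbitrary: y)
  case (Suc n)
  then obtain z where z: "(E ^^ n) x z" "E z y" by auto
  show ?case
  proof (cases "z \<in> P")
    case True
    then show ?thesis using z Suc.prems by (meson le_SucI order_refl)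
  next
    case False
    then show ?thesis using Suc.IH[OF z(1) Suc.prems(2)] le_SucI by blast
  qed
qed auto

context proper_unbounded
begin

text \<open>A geodesic of the model space is sampled at unit steps, mapped back by \<open>g\<close>
  and rounded to the net. The number of samples is controlled by the length of the geodesic, hence
  by \<open>r\<close> alone. Bounded geometry makes the net locally finite.\<close>

lemma exists_net_graph:
  assumes geo: "coarsely_geodesic TYPE('b) X" and geom: "coarse_bounded_geometry X"
  shows "\<exists>A c R. A \<subseteq> M \<and> (\<forall>x \<in> M. \<exists>z \<in> A. d x z \<le> c) \<and> (\<forall>t. finite {z \<in> A. d a z \<le> t}) \<and> 0 \<le> R \<and>
    (\<forall>r. \<exists>N. \<forall>x \<in> A. \<forall>y \<in> A. d x y \<le> r \<longrightarrow>
      (\<exists>n \<le> N. ((\<lambda>x y. x \<in> A \<and> y \<in> A \<and> d x y \<le> R) ^^ n) x y))"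
proof -
  obtain A lam where A: "net_in X A"
    and fin: "\<And>x t. x \<in> M \<Longrightarrow> t > 0 \<Longrightarrow> finite (A \<inter> mcball_of X x t)"
    using geom by (fastforce simp: coarse_bounded_geometry_def)
  obtain c where AM: "A \<subseteq> M" and c: "c > 0" "\<And>x. x \<in> M \<Longrightarrow> \<exists>z \<in> A. d x z < c"
    using A by (auto simp: net_in_def)
  obtain nr where nr: "\<And>x. x \<in> M \<Longrightarrow> nr x \<in> A \<and> d x (nr x) < c" using c(2) by metis
  obtain Y :: "'b metric" and f g where Y: "geodesic_metric Y" and f: "coarse_map X Y f"
    and g: "coarse_map Y X g" and gf: "close_maps X X (g \<circ> f) id"
    using geo by (auto simp: coarsely_geodesic_def coarsely_equivalent_def coarse_equivalence_def)
  obtain \<sigma> where \<sigma>: "mono_on {0..} \<sigma>" "\<And>x x'. x \<in> M \<Longrightarrow> x' \<in> M \<Longrightarrow> mdist Y (f x) (f x') \<le> \<sigma> (d x x')"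
    and fM: "\<And>x. x \<in> M \<Longrightarrow> f x \<in> mspace Y"
    using f by (fastforce simp: coarse_map_def)
  obtain \<tau> where \<tau>: "mono_on {0..} \<tau>" "\<tau> \<in> {0..} \<rightarrow> {0::real..}"
    "\<And>y y'. y \<in> mspace Y \<Longrightarrow> y' \<in> mspace Y \<Longrightarrow> d (g y) (g y') \<le> \<tau> (mdist Y y y')"
    and gM: "\<And>y. y \<in> mspace Y \<Longrightarrow> g y \<in> M"
    using g by (fastforce simp: coarse_map_def)
  obtain r0 where r0: "r0 > 0" "\<And>x. x \<in> M \<Longrightarrow> d (g (f x)) x < r0"
    using gf by (auto simp: close_maps_def)
  \<comment> \<open>The first bound is for consecutive rounded samples, the second for the hop
    between a net point \<open>x\<close> and the rounding of \<open>g (f x)\<close>.\<close>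
  define R where "R = max (\<tau> 1 + 2 * c) (r0 + c)"
  have R: "0 \<le> R" "\<tau> 1 + 2 * c \<le> R" "r0 + c \<le> R" using r0(1) c(1) by (auto simp: R_def)
  define E where "E x y \<longleftrightarrow> x \<in> A \<and> y \<in> A \<and> d x y \<le> R" for x y
  have E_sym: "E x y \<Longrightarrow> E y x" for x y by (auto simp: E_def mdist_commute)
  have start: "E x (nr (g (f x)))" if "x \<in> A" for x
  proof -
    have xM: "x \<in> M" "g (f x) \<in> M" using that AM fM gM by auto
    then have nM: "nr (g (f x)) \<in> M" using nr AM by blast
    have "d x (nr (g (f x))) \<le> d x (g (f x)) + d (g (f x)) (nr (g (f x)))" using mdist_triangle xM nM by metis
    also have "\<dots> \<le> R" using r0(2)[OF xM(1)] nr[OF xM(2)] R(3) mdist_commute[of X x] by auto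
    finally show ?thesis using that nr xM by (auto simp: E_def)
  qed
  have next_step: "E (nr (g y)) (nr (g y'))" if y: "y \<in> mspace Y" "y' \<in> mspace Y" "mdist Y y y' \<le> 1" for y y'
  proof -
    have yM: "g y \<in> M" "g y' \<in> M" using y gM by auto
    then have nM: "nr (g y) \<in> M" "nr (g y') \<in> M" using nr AM by blast+
    have "d (nr (g y)) (nr (g y')) \<le> d (nr (g y)) (g y) + d (g y) (nr (g y'))" using mdist_triangle yM nM by metis
    also have "d (g y) (nr (g y')) \<le> d (g y) (g y') + d (g y') (nr (g y'))" using mdist_triangle yM nM by metis
    also have "d (g y) (g y') \<le> \<tau> 1"
      using \<tau>(3)[OF y(1,2)] mono_onD[OF \<tau>(1), of "mdist Y y y'" 1] y(3) by simp
    finally show ?thesis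
      using nr[OF yM(1)] nr[OF yM(2)] R(2) mdist_commute[of X "nr (g y)"] by (auto simp: E_def)
  qed
  have "\<exists>N. \<forall>x \<in> A. \<forall>y \<in> A. d x y \<le> r \<longrightarrow> (\<exists>n \<le> N. (E ^^ n) x y)" for r
  proof (rule exI[of _ "nat \<lceil>\<sigma> r\<rceil> + 2"], intro ballI impI)
    fix x y assume xy: "x \<in> A" "y \<in> A" "d x y \<le> r"
    have xyM: "x \<in> M" "y \<in> M" using xy AM by auto
    define L where "L = mdist Y (f x) (f y)"
    have L: "0 \<le> L" by (simp add: L_def)
    have "\<sigma> (d x y) \<le> \<sigma> r"
      using xy(3) order_trans[OF mdist_nonneg[of X x y]] by (intro mono_onD[OF \<sigma>(1)]) auto
    then have L\<sigma>: "L \<le> \<sigma> r" using \<sigma>(2)[OF xyM] by (simp add: L_def)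
    obtain p where p: "p \<in> {0..L} \<rightarrow> mspace Y" "p 0 = f x" "p L = f y"
      "\<And>s t. s \<in> {0..L} \<Longrightarrow> t \<in> {0..L} \<Longrightarrow> mdist Y (p s) (p t) = \<bar>s - t\<bar>"
      using Y fM[OF xyM(1)] fM[OF xyM(2)] unfolding geodesic_metric_def L_def by blast
    define k where "k = nat \<lceil>L\<rceil>"
    \<comment> \<open>Capping the parameter at \<open>L\<close> makes the last sample the endpoint
      even if \<open>L\<close> is not an integer.\<close>
    define b where "b i = nr (g (p (min (real i) L)))" for i
    have "E (b i) (b (Suc i))" for i
      unfolding b_def
    proof (rule next_step)
      have m: "min (real j) L \<in> {0..L}" for j :: nat using L by auto
      show "p (min (real i) L) \<in> mspace Y" "p (min (real (Suc i)) L) \<in> mspace Y" using p(1) m by blast+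
      have "mdist Y (p (min (real i) L)) (p (min (real (Suc i)) L)) = \<bar>min (real i) L - min (real (Suc i)) L\<bar>"
        using p(4) m by blast
      also have "\<dots> \<le> 1" by auto
      finally show "mdist Y (p (min (real i) L)) (p (min (real (Suc i)) L)) \<le> 1" .
    qed
    then have "(E ^^ k) (b 0) (b k)" by (intro relpowp_chain)
    moreover have "b 0 = nr (g (f x))" using p(2) L by (simp add: b_def)
    moreover have "L \<le> real k" unfolding k_def by linarith
    then have "b k = nr (g (f y))" using p(3) by (simp add: b_def min_absorb2)
    ultimately have "(E ^^ Suc k) x (nr (g (f y)))" using start[OF xy(1)] by (metis relpowp_Suc_I2)
    then have "(E ^^ Suc (Suc k)) x y" using E_sym[OF start[OF xy(2)]] by (rule relpowp_Suc_I)
    moreover have "Suc (Suc k) \<le> nat \<lceil>\<sigma> r\<rceil> + 2"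
      using nat_mono[OF ceiling_mono[OF L\<sigma>]] unfolding k_def by linarith
    ultimately show "\<exists>n \<le> nat \<lceil>\<sigma> r\<rceil> + 2. (E ^^ n) x y" by blast
  qed
  moreover have "finite {z \<in> A. d a z \<le> t}" for t
    by (rule finite_subset[OF _ fin[OF base, of "max t 1"]]) (use AM base in auto)
  moreover have "\<forall>x \<in> M. \<exists>z \<in> A. d x z \<le> c" using c(2) less_imp_le by blast
  ultimately show ?thesis
    using AM R(1) unfolding E_def by blast
qed

end

text \<open>The chain condition bounds graph distance in terms of \<open>d\<close>; the bound in the
  other direction comes from the edge length \<open>R\<close>. So on the net the two distances are
  coarsely the same.\<close>

locale net_graph = proper_unbounded X a for X :: "'a metric" and a +
  fixes A :: "'a set" and c R :: real
  assumes A_sub: "A \<subseteq> M" and A_net: "x \<in> M \<Longrightarrow> \<exists>z \<in> A. d x z \<le> c"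
    and A_fin: "finite {z \<in> A. d a z \<le> t}" and R_nonneg: "0 \<le> R"
    and A_chain: "\<exists>N. \<forall>x \<in> A. \<forall>y \<in> A. d x y \<le> r \<longrightarrow>
      (\<exists>n \<le> N. ((\<lambda>x y. x \<in> A \<and> y \<in> A \<and> d x y \<le> R) ^^ n) x y)"
begin

definition adj :: "'a \<Rightarrow> 'a \<Rightarrow> bool" where
  "adj = (\<lambda>x y. x \<in> A \<and> y \<in> A \<and> d x y \<le> R)"

lemma bdd_iff_finite: "S \<subseteq> A \<Longrightarrow> bdd S \<longleftrightarrow> finite S"
proof
  assume S: "S \<subseteq> A" "bdd S"
  then obtain t where "\<forall>s \<in> S. d a s \<le> t" by (auto simp: bdd_def)
  then have "S \<subseteq> {z \<in> A. d a z \<le> t}" using S by blast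
  then show "finite S" using A_fin finite_subset by blast
next
  assume "finite S"
  then have "d a s \<le> Max (d a ` S)" if "s \<in> S" for s using that by auto
  then show "bdd S" by (rule bddI)
qed

lemma trace_A: "corona_trace A = corona"
proof -
  have "corona_trace M \<subseteq> corona_trace A" using A_net by (intro trace_nbhd[of M A c]) (use A_sub in auto)
  then show ?thesis using trace_M trace_subset by blast
qed

lemma A_infinite: "infinite A"
proof
  assume "finite A"
  then have "bdd A" using bdd_iff_finite by blast
  then have "corona = {}" using trace_bdd[OF A_sub] trace_A by blast
  then show False using trace_nonempty[of M] not_bdd_space trace_M by auto
qed

sublocale loc_fin_graph A adj
proof
  show "adj x y \<Longrightarrow> x \<in> A \<and> y \<in> A" for x y by (simp add: adj_def)
  show "adj x y \<Longrightarrow> adj y x" for x y by (simp add: adj_def mdist_commute)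
  show "finite {y. adj x y}" for x
  proof (rule finite_subset)
    show "{y. adj x y} \<subseteq> {z \<in> A. d a z \<le> d a x + R}"
      using tri[of x] A_sub by (fastforce simp: adj_def)
  qed (rule A_fin)
  show "adj\<^sup>*\<^sup>* x y" if xy: "x \<in> A" "y \<in> A" for x y
  proof -
    obtain n where "(adj ^^ n) x y"
      using A_chain[of "d x y"] xy unfolding adj_def by (meson order_refl)
    then show ?thesis by (rule relpowp_imp_rtranclp)
  qed
  show "infinite A" by (rule A_infinite)
qed

section \<open>Graph distance and the metric\<close>

lemma relpowp_dist:
  assumes "(adj ^^ n) x y" "x \<in> A" shows "y \<in> A \<and> d x y \<le> real n * R"
  using assms
proof (induction n arbitrary: y)
  case 0
  then have "d x y = 0" using A_sub by auto
  then show ?case using 0 by simp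
next
  case (Suc n)
  then obtain z where z: "(adj ^^ n) x z" "adj z y" by auto
  then have 1: "z \<in> A" "d x z \<le> real n * R" using Suc.IH[OF z(1) Suc.prems(2)] by auto
  moreover have 2: "y \<in> A" "d z y \<le> R" using z(2) by (auto simp: adj_def)
  moreover have "d x y \<le> d x z + d z y"
    by (rule mdist_triangle) (use 1 2 Suc.prems A_sub in auto)
  ultimately show ?case by (simp add: algebra_simps)
qed

lemma dist_le_gdist: "x \<in> A \<Longrightarrow> y \<in> A \<Longrightarrow> d x y \<le> real (gdist x y) * R"
  using relpowp_dist relpowp_gdist by blast

lemma gdist_bound: "\<exists>N. \<forall>x \<in> A. \<forall>y \<in> A. d x y \<le> r \<longrightarrow> gdist x y \<le> N"
proof -
  obtain N where "\<forall>x \<in> A. \<forall>y \<in> A. d x y \<le> r \<longrightarrow> (\<exists>n \<le> N. (adj ^^ n) x y)"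
    using A_chain[of r] unfolding adj_def by blast
  then show ?thesis using gdist_le order_trans by blast
qed

section \<open>Edge cuts, ends and connected traces\<close>

text \<open>A path of boundedly many edges from \<open>P\<close> to its complement crosses one of
  finitely many edges, so its starting point is at bounded distance from a bounded set.\<close>

lemma finite_cut_coarsely_disjoint:
  assumes P: "P \<subseteq> A" and fin: "finite {(p, q). p \<in> P \<and> q \<in> A - P \<and> adj p q}"
  shows "coarsely_disjoint P (A - P)"
  unfolding coarsely_disjoint_def
proof
  fix r
  define Ed where "Ed = {(p, q). p \<in> P \<and> q \<in> A - P \<and> adj p q}"
  have "bdd (fst ` Ed)" using fin P by (subst bdd_iff_finite) (auto simp: Ed_def)
  then obtain t where t: "\<forall>s \<in> fst ` Ed. d a s \<le> t" by (auto simp: bdd_def)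
  obtain N where N: "\<forall>x \<in> A. \<forall>y \<in> A. d x y \<le> r \<longrightarrow> gdist x y \<le> N" using gdist_bound by blast
  have "d a x \<le> t + real N * R" if xy: "x \<in> P" "y \<in> A - P" "d x y \<le> r" for x y
  proof -
    have xA: "x \<in> A" "y \<in> A" using xy P by auto
    then obtain m u v where m: "m \<le> gdist x y" "(adj ^^ m) x u" "adj u v" "u \<in> P" "v \<notin> P"
      using relpowp_crossing[OF relpowp_gdist[OF xA], of P] xy by auto
    have "(u, v) \<in> Ed" using m E_in[OF m(3)] by (auto simp: Ed_def)
    then have "d a u \<le> t" using t by force
    moreover have "d x u \<le> real m * R" "u \<in> A" using relpowp_dist[OF m(2) xA(1)] by auto
    moreover have "real m * R \<le> real N * R"
      using m(1) N xA xy(3) R_nonneg by (intro mult_right_mono) force+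
    moreover have "d a x \<le> d a u + d u x" using tri calculation xA A_sub by blast
    ultimately show ?thesis using mdist_commute[of X x u] by simp
  qed
  then show "\<exists>R. \<forall>x\<in>P. \<forall>y\<in>A - P. d x y \<le> r \<longrightarrow> d a x \<le> R" by blast
qed

lemma one_ended_if_connected:
  assumes con: "connectedin PT corona"
  shows "one_ended A"
  unfolding one_ended_def
proof (intro allI impI notI)
  fix P assume P: "P \<subseteq> A" "infinite P" "infinite (A - P)"
    and fin: "finite {(p, q). p \<in> P \<and> q \<in> A - P \<and> adj p q}"
  have sub: "P \<subseteq> M" "A - P \<subseteq> M" using P A_sub by auto
  have ne: "corona_trace P \<noteq> {}" "corona_trace (A - P) \<noteq> {}"
    using trace_nonempty sub bdd_iff_finite P by auto
  have "corona = corona_trace P \<union> corona_trace (A - P)"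
    using trace_Un[of P "A - P"] P(1) trace_A by (simp add: Un_absorb1)
  then show False
    using connectedin_trace_split[OF con sub finite_cut_coarsely_disjoint[OF P(1) fin]] ne by blast
qed

lemma range_not_bdd:
  assumes "o' \<in> A" "\<And>n::nat. x n \<in> A" "\<And>n. n < gdist o' (x n)"
  shows "\<not> bdd (range x)"
proof
  assume "bdd (range x)"
  then have "finite (range x)" using bdd_iff_finite[of "range x"] assms(2) by blast
  then obtain N where "range x \<subseteq> gball o' N" using finite_subset_gball[of "range x"] assms(2) by blast
  then have "gdist o' (x N) \<le> N" by (auto simp: gball_def)
  then show False using assms(3)[of N] by simp
qed

text \<open>Distance at most \<open>r\<close> forces graph distance at most some \<open>N\<close>,
  so only the centres with index below \<open>N\<close> can be within \<open>r\<close> of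
  \<open>W\<close>.\<close>

lemma balls_coarsely_disjoint:
  assumes x: "\<And>n. x n \<in> A" and W: "W \<subseteq> A" and ball: "\<And>n. gball (x n) n \<inter> W = {}"
  shows "coarsely_disjoint (range x) W"
  unfolding coarsely_disjoint_def
proof
  fix r
  obtain N where N: "\<forall>x \<in> A. \<forall>y \<in> A. d x y \<le> r \<longrightarrow> gdist x y \<le> N" using gdist_bound by blast
  have "bdd (x ` {..<N})" using x by (subst bdd_iff_finite) auto
  then obtain t where t: "\<forall>s \<in> x ` {..<N}. d a s \<le> t" by (auto simp: bdd_def)
  have "d a (x n) \<le> t" if w: "w \<in> W" "d (x n) w \<le> r" for n w
  proof -
    have "w \<notin> gball (x n) n" "w \<in> A" using ball w W by auto
    then have "n < gdist (x n) w" by (auto simp: gball_def)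
    then have "n < N" using N x w(2) \<open>w \<in> A\<close> by (meson order_less_le_trans)
    then show ?thesis using t by blast
  qed
  then show "\<exists>R. \<forall>x\<in>range x. \<forall>y\<in>W. d x y \<le> r \<longrightarrow> d a x \<le> R" by blast
qed

text \<open>Far out \<open>f\<close> changes by less than 1 along an edge, so an edge leaving the
  negative part ends in the gap. The gap is bounded, and hence only finitely many such edges
  exist.\<close>

lemma one_ended_trace_connected:
  assumes Z: "Z \<subseteq> A" "one_ended Z"
  shows "connectedin PT (corona_trace Z)"
proof (rule trace_connectedI)
  show "Z \<subseteq> M" using Z A_sub by blast
  fix f assume f: "f \<in> H" "bdd {s \<in> Z. 0 \<le> f s \<and> f s \<le> 1}"
  define P where "P = {s \<in> Z. f s < 0}"
  show "bdd {s \<in> Z. f s < 0} \<or> bdd {s \<in> Z. 1 < f s}"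
  proof (rule ccontr)
    assume "\<not> (bdd {s \<in> Z. f s < 0} \<or> bdd {s \<in> Z. 1 < f s})"
    then have nb: "\<not> bdd P" "\<not> bdd {s \<in> Z. 1 < f s}" by (auto simp: P_def)
    have PZ: "P \<subseteq> Z" by (auto simp: P_def)
    have "infinite P" using nb(1) bdd_iff_finite[of P] PZ Z by blast
    moreover have "\<not> bdd (Z - P)"
      using nb(2) bdd_subset[of "Z - P" "{s \<in> Z. 1 < f s}"] by (force simp: P_def)
    then have "infinite (Z - P)" using bdd_iff_finite[of "Z - P"] Z by blast
    ultimately have inf: "infinite {(p, q). p \<in> P \<and> q \<in> Z - P \<and> adj p q}"
      using Z(2) PZ unfolding one_ended_def by blast
    obtain R1 where R1: "\<forall>x \<in> M. \<forall>y \<in> M. R1 < d a x \<longrightarrow> d x y \<le> R \<longrightarrow> \<bar>f x - f y\<bar> < 1"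
      using higson_osc[OF f(1), of 1 R] by auto
    obtain R2 where R2: "\<forall>s \<in> {s \<in> Z. 0 \<le> f s \<and> f s \<le> 1}. d a s \<le> R2" using f(2) by (auto simp: bdd_def)
    let ?K = "{z \<in> A. d a z \<le> max R1 (R2 + R)}"
    have "{(p, q). p \<in> P \<and> q \<in> Z - P \<and> adj p q} \<subseteq> (\<Union>p \<in> ?K. {p} \<times> {q. adj p q})"
    proof clarify
      fix p q assume pq: "p \<in> P" "q \<in> Z" "q \<notin> P" "adj p q"
      have pqA: "p \<in> A" "q \<in> A" "p \<in> M" "q \<in> M" "d p q \<le> R"
        using pq(4) A_sub by (auto simp: adj_def)
      have "d a p \<le> max R1 (R2 + R)"
      proof (rule ccontr)
        assume "\<not> d a p \<le> max R1 (R2 + R)"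
        then have far: "R1 < d a p" "R2 + R < d a p" by auto
        then have "\<bar>f p - f q\<bar> < 1" using R1 pqA by blast
        moreover have "f p < 0" "0 \<le> f q" using pq by (auto simp: P_def)
        ultimately have "d a q \<le> R2" using R2 pq(2) by auto
        then show False using tri[of q p] pqA far mdist_commute[of X p q] by simp
      qed
      then show "(p, q) \<in> (\<Union>p \<in> ?K. {p} \<times> {q. adj p q})" using pq(4) pqA by auto
    qed
    moreover have "finite (\<Union>p \<in> ?K. {p} \<times> {q. adj p q})"
      using A_fin E_fin by auto
    ultimately show False using inf finite_subset by blast
  qed
qed

section \<open>Holes, rays and decomposability\<close>

text \<open>A limit point of the centres \<open>x n\<close> of removed balls shows that the trace of
  \<open>Z\<close> is proper. A limit point of the centres \<open>y n\<close> of intact balls avoids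
  the trace of \<open>A - Z\<close>, whose complement in the corona is therefore a nonempty open
  subset of the trace of \<open>Z\<close>.\<close>

lemma decomposable_if_holes:
  assumes cont: "continuum (higson_corona X)" and o': "o' \<in> A"
    and Z: "Z \<subseteq> A" "one_ended Z"
    and x: "\<And>n. x n \<in> A \<and> n < gdist o' (x n) \<and> gball (x n) n \<inter> Z = {}"
    and y: "\<And>n. y n \<in> A \<and> n < gdist o' (y n) \<and> gball (y n) n \<subseteq> Z"
  shows "decomposable (higson_corona X)"
proof -
  have subM: "Z \<subseteq> M" "A - Z \<subseteq> M" "range x \<subseteq> M" "range y \<subseteq> M" using Z x y A_sub by auto
  obtain u where u: "u \<in> corona_trace (range x)"
    using trace_nonempty[OF subM(3) range_not_bdd[OF o']] x by blast
  obtain v where v: "v \<in> corona_trace (range y)"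
    using trace_nonempty[OF subM(4) range_not_bdd[OF o']] y by blast
  have "coarsely_disjoint (range x) Z"
    using x Z by (intro balls_coarsely_disjoint) auto
  then have uZ: "u \<notin> corona_trace Z" using trace_disjoint[OF subM(3,1)] u by blast
  have "coarsely_disjoint (range y) (A - Z)"
    using y Z by (intro balls_coarsely_disjoint) auto
  then have vW: "v \<notin> corona_trace (A - Z)" using trace_disjoint[OF subM(4,2)] v by blast
  have split: "corona = corona_trace Z \<union> corona_trace (A - Z)"
    using trace_Un[of Z "A - Z"] Z(1) trace_A by (simp add: Un_absorb1)
  have uv: "u \<in> corona" "v \<in> corona" using u v trace_subset by auto
  have closed: "closedin (higson_corona X) (corona_trace S)" for S
    using closedin_trace trace_subset by (auto simp: higson_corona_eq closedin_subtopology)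
  show ?thesis
  proof (rule decomposableI[OF cont])
    have "connectedin (higson_corona X) (corona_trace Z)"
      using connectedin_corona_iff[OF trace_subset] one_ended_trace_connected[OF Z] by simp
    moreover have "corona_trace Z \<noteq> {}" using uv vW split by blast
    ultimately show "subcontinuum (higson_corona X) (corona_trace Z)"
      using cont closed by (intro subcontinuumI) (auto simp: continuum_def)
    show "corona_trace Z \<noteq> topspace (higson_corona X)" using uZ uv topspace_corona by blast
    show "openin (higson_corona X) (corona - corona_trace (A - Z))"
      using closed[of "A - Z"] unfolding closedin_def topspace_corona by blast
    show "corona - corona_trace (A - Z) \<noteq> {}" using uv vW by blast
    show "corona - corona_trace (A - Z) \<subseteq> corona_trace Z" using split by blast
  qed
qed

text \<open>The coordinate is the graph distance from the root to a nearby net point. On a geodesic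
  ray this distance is the index, so a net point within \<open>m\<close> of \<gamma> at index
  \<open>k\<close> has a coordinate within \<open>m\<close> of \<open>k\<close>.\<close>

lemma ray_coordinates_if_near:
  assumes o': "o' \<in> A" and \<gamma>: "\<And>n. gdist o' (\<gamma> n) = n" "\<And>n. adj (\<gamma> n) (\<gamma> (Suc n))"
    and near: "\<And>x. x \<in> A \<Longrightarrow> \<exists>k. gdist x (\<gamma> k) \<le> m"
  shows "\<exists>h. ray_coordinates h \<gamma>"
proof -
  obtain nr where nr: "\<And>x. x \<in> M \<Longrightarrow> nr x \<in> A \<and> d x (nr x) \<le> c" using A_net by metis
  have \<gamma>A: "\<gamma> n \<in> A" for n using E_in[OF \<gamma>(2)] by blast
  then have \<gamma>M: "\<gamma> n \<in> M" for n using A_sub by blast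
  have \<gamma>R: "d (\<gamma> n) (\<gamma> (Suc n)) \<le> R" for n using \<gamma>(2) by (simp add: adj_def)
  have diff: "\<bar>real (gdist o' x) - real (gdist o' y)\<bar> \<le> real (gdist x y)" if "x \<in> A" "y \<in> A" for x y
    using gdist_triangle[OF o' that] gdist_triangle[OF o' that(2,1)] gdist_sym[OF that] by linarith
  define h where "h x = gdist o' (nr x)" for x
  have "\<exists>t. \<forall>x \<in> M. \<forall>y \<in> M. d x y \<le> r \<longrightarrow> \<bar>real (h x) - real (h y)\<bar> \<le> t" for r
  proof -
    obtain N where N: "\<forall>x \<in> A. \<forall>y \<in> A. d x y \<le> c + r + c \<longrightarrow> gdist x y \<le> N" using gdist_bound by blast
    have "\<bar>real (h x) - real (h y)\<bar> \<le> real N" if xy: "x \<in> M" "y \<in> M" "d x y \<le> r" for x y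
    proof -
      have nM: "nr x \<in> M" "nr y \<in> M" "nr x \<in> A" "nr y \<in> A" using nr xy A_sub by auto
      have "d (nr x) (nr y) \<le> d (nr x) x + d x (nr y)" using mdist_triangle nM xy by metis
      also have "d x (nr y) \<le> d x y + d y (nr y)" using mdist_triangle nM xy by metis
      finally have "d (nr x) (nr y) \<le> c + r + c"
        using nr[OF xy(1)] nr[OF xy(2)] xy(3) mdist_commute[of X x "nr x"] by auto
      then have "gdist (nr x) (nr y) \<le> N" using N nM by blast
      then show ?thesis using diff[OF nM(3,4)] by (simp add: h_def)
    qed
    then show ?thesis by blast
  qed
  moreover have "d x (\<gamma> (h x)) \<le> c + real m * R + R * real m" if x: "x \<in> M" for x
  proof -
    have z: "nr x \<in> A" "nr x \<in> M" "d x (nr x) \<le> c" using nr[OF x] A_sub by auto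
    obtain k where k: "gdist (nr x) (\<gamma> k) \<le> m" using near[OF z(1)] by blast
    have "d x (\<gamma> (h x)) \<le> d x (nr x) + d (nr x) (\<gamma> (h x))" using mdist_triangle x z \<gamma>M by metis
    also have "d (nr x) (\<gamma> (h x)) \<le> d (nr x) (\<gamma> k) + d (\<gamma> k) (\<gamma> (h x))" using mdist_triangle z \<gamma>M by metis
    also have "d (nr x) (\<gamma> k) \<le> real m * R"
      using dist_le_gdist[OF z(1) \<gamma>A, of k] mult_right_mono[of "real (gdist (nr x) (\<gamma> k))" "real m" R] k R_nonneg
      by simp
    also have "d (\<gamma> k) (\<gamma> (h x)) \<le> R * \<bar>real k - real (h x)\<bar>"
      using chain_dist_le[of \<gamma> X R, OF \<gamma>M \<gamma>R] .
    also have "R * \<bar>real k - real (h x)\<bar> \<le> R * real m"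
      using diff[OF z(1) \<gamma>A, of k] k \<gamma>(1)[of k] R_nonneg by (intro mult_left_mono) (auto simp: h_def)
    finally show ?thesis using z(3) by simp
  qed
  moreover have "\<exists>N. \<forall>n. \<bar>real (h (\<gamma> n)) - real n\<bar> \<le> N"
  proof -
    obtain N where N: "\<forall>x \<in> A. \<forall>y \<in> A. d x y \<le> c \<longrightarrow> gdist x y \<le> N" using gdist_bound by blast
    have "\<bar>real (h (\<gamma> n)) - real n\<bar> \<le> real N" for n
    proof -
      have z: "nr (\<gamma> n) \<in> A" "d (\<gamma> n) (nr (\<gamma> n)) \<le> c" using nr[OF \<gamma>M] by auto
      then have "gdist (\<gamma> n) (nr (\<gamma> n)) \<le> N" using N \<gamma>A by blast
      then show ?thesis using diff[OF \<gamma>A z(1), of n] \<gamma>(1)[of n] by (simp add: h_def)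
    qed
    then show ?thesis by blast
  qed
  ultimately have "ray_coordinates h \<gamma>" unfolding ray_coordinates_def using \<gamma>M \<gamma>R by blast
  then show ?thesis by blast
qed

text \<open>If a geodesic ray yields no coordinates, then for every \<open>n\<close> some vertex is
  further than \<open>n\<close> from the entire ray, which is exactly the room needed for the
  holes.\<close>

lemma ray_coordinates_if_indecomposable:
  assumes ind: "indecomposable_continuum (higson_corona X)"
  shows "\<exists>h g. ray_coordinates h g"
proof (rule ccontr)
  assume no: "\<nexists>h g. ray_coordinates h g"
  have cont: "continuum (higson_corona X)" using ind by (simp add: indecomposable_continuum_def)
  then have oe: "one_ended A" using one_ended_if_connected continuum_corona_iff by blast
  obtain o' where o': "o' \<in> A" using A_infinite by (metis ex_in_conv finite.emptyI)
  obtain \<gamma> where \<gamma>: "\<gamma> 0 = o'" "\<And>n. gdist o' (\<gamma> n) = n" "\<And>n. adj (\<gamma> n) (\<gamma> (Suc n))"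
    using exists_ray[OF o'] by blast
  have "\<exists>x \<in> A. \<forall>k. n < gdist x (\<gamma> k)" for n
    using ray_coordinates_if_near[OF o' \<gamma>(2,3), of n] no by (meson not_le)
  from exists_one_ended_with_holes[OF oe o' \<gamma> this] obtain Z x y where Z: "Z \<subseteq> A" "one_ended Z"
    and x: "\<And>n. x n \<in> A \<and> n < gdist o' (x n) \<and> gball (x n) n \<inter> Z = {}"
    and y: "\<And>n. y n \<in> A \<and> n < gdist o' (y n) \<and> gball (y n) n \<subseteq> Z" by blast
  from decomposable_if_holes[OF cont o' Z x y] show False
    using ind by (simp add: indecomposable_continuum_def)
qed

end

theorem corollary3p11:
  fixes X :: "'a metric"
  assumes "\<not> compact_space (mtopology_of X)"
    and "proper_metric X"
    and "coarsely_geodesic TYPE('b) X"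
    and "coarse_bounded_geometry X"
  shows "indecomposable_continuum (higson_corona X) \<longleftrightarrow> coarsely_equivalent X nat_metric"
proof -
  \<comment> \<open>The empty space is compact, so noncompactness supplies a base point.\<close>
  have "topspace (mtopology_of X) \<noteq> {}"
    using assms(1) by (metis compact_space_def compactin_empty)
  then obtain a where "a \<in> mspace X" by auto
  then interpret proper_unbounded X a using assms(1,2) by unfold_locales
  obtain A c R where A: "A \<subseteq> M" "\<forall>x \<in> M. \<exists>z \<in> A. d x z \<le> c" "\<forall>t. finite {z \<in> A. d a z \<le> t}" "0 \<le> R"
    "\<forall>r. \<exists>N. \<forall>x \<in> A. \<forall>y \<in> A. d x y \<le> r \<longrightarrow>
      (\<exists>n \<le> N. ((\<lambda>x y. x \<in> A \<and> y \<in> A \<and> d x y \<le> R) ^^ n) x y)"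
    using exists_net_graph[OF assms(3,4)] by (elim exE conjE)
  interpret net_graph X a A c R
    by unfold_locales (use A in simp_all)
  show ?thesis
    using ray_coordinates_if_indecomposable coarse_equivalence_of_ray_coordinates
      ray_coordinates_of_coarse_equivalence ray_corona_indecomposable by blast
qed

end
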